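(* There are at least 21 pairwise inequivalent formally self-dual additive $(11,2^{11},5)$ codes over $\mathrm{GF}(4)$. Specifically, there exist 21 pairwise inequivalent such codes, realizing the following five weight enumerators with the following automorphism group orders: $$W_{11,1}(1,y)=1+55y^5+242y^6+275y^7+495y^8+605y^9+286y^{10}+89y^{11},$$ $$W_{11,2}(1,y)=1+66y^5+198y^6+330y^7+495y^8+550y^9+330y^{10}+78y^{11},$$ $$W_{11,3}(1,y)=1+70y^5+182y^6+350y^7+495y^8+530y^9+346y^{10}+74y^{11},$$ $$W_{11,4}(1,y)=1+75y^5+162y^6+375y^7+495y^8+505y^9+366y^{10}+69y^{11},$$ $$W_{11,5}(1,y)=1+77y^5+154y^6+385y^7+495y^8+495y^9+374y^{10}+67y^{11};$$ five codes have weight enumerator $W_{11,1}$ (three with automorphism group of order 11, one of order 10, one of order 110), four have $W_{11,2}$ (all of order 11), two have $W_{11,3}$ (both of order 10), five have $W_{11,4}$ (all of order 10), and five have $W_{11,5}$ (all of order 11).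
   Context: $\mathrm{GF}(4)=\{0,1,\omega,\omega^2\}$ with $\omega^2=\omega+1$; conjugation is $\overline{x}=x^2$ and $\mathrm{Tr}(x)=x+\overline{x}$. An additive $(n,2^k,d)$ code over $\mathrm{GF}(4)$ is an additive subgroup of $\mathrm{GF}(4)^n$ with $2^k$ elements and minimum nonzero Hamming weight $d$. The weight enumerator is $W_{\mathcal{C}}(x,y)=\sum_{i=0}^n A_i x^{n-i}y^i$, with $A_i$ the number of codewords of Hamming weight $i$. The dual is $\mathcal{C}^\perp=\{\boldsymbol{u}\in\mathrm{GF}(4)^n \mid \sum_i\mathrm{Tr}(u_i\overline{c_i})=0 \text{ for all } \boldsymbol{c}\in\mathcal{C}\}$; $\mathcal{C}$ is formally self-dual if $W_{\mathcal{C}}=W_{\mathcal{C}^\perp}$. Consider the $6^n n!$ maps of $\mathrm{GF}(4)^n$ consisting of a permutation of coordinates, followed by multiplication of individual coordinates by nonzero elements of $\mathrm{GF}(4)$, followed by conjugation of some of the coordinates. Two codes are equivalent if such a map sends one onto the other; the automorphism group of a code consists of all such maps sending the code onto itself. *)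

theory Defs
  imports
    "HOL-Analysis.Finite_Cartesian_Product"
    "HOL-Computational_Algebra.Polynomial"
    "HOL-Library.Numeral_Type"
    "HOL-Library.Z2"
begin

(* GF4 a b stands for a + b * omega; multiplication reduces by omega^2 = omega + 1,
   and the inverse of x is x^2, written out (it is 0 at 0). *)
datatype gf4 = GF4 bit bit

instantiation gf4 :: field
begin

definition "0 = GF4 0 0"

definition "1 = GF4 1 0"

fun plus_gf4 :: "gf4 \<Rightarrow> gf4 \<Rightarrow> gf4" where
  "GF4 a b + GF4 c d = GF4 (a + c) (b + d)"

definition uminus_gf4 :: "gf4 \<Rightarrow> gf4" where
  "- x = (x :: gf4)"

definition minus_gf4 :: "gf4 \<Rightarrow> gf4 \<Rightarrow> gf4" where
  "x - y = x + (y :: gf4)"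

fun times_gf4 :: "gf4 \<Rightarrow> gf4 \<Rightarrow> gf4" where
  "GF4 a b * GF4 c d = GF4 (a * c + b * d) (a * d + b * c + b * d)"

fun inverse_gf4 :: "gf4 \<Rightarrow> gf4" where
  "inverse (GF4 a b) = GF4 (a + b) b"

definition divide_gf4 :: "gf4 \<Rightarrow> gf4 \<Rightarrow> gf4" where
  "x div y = x * inverse (y :: gf4)"

instance
proof
  fix x y z :: gf4
  obtain a b c d e f where xyz: "x = GF4 a b" "y = GF4 c d" "z = GF4 e f"
    by (metis gf4.exhaust)
  note defs = xyz zero_gf4_def one_gf4_def uminus_gf4_def minus_gf4_def divide_gf4_def
  show "x + y + z = x + (y + z)" "x + y = y + x" "0 + x = x" "- x + x = 0" "x - y = x + - y"
    "1 * x = x" "x div y = x * inverse y" "(0 :: gf4) \<noteq> 1" "inverse (0 :: gf4) = 0"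
    by (simp_all add: defs ac_simps del: add_bit_eq_xor mult_bit_eq_and)
  show "x * y = y * x"
    by (simp add: defs ac_simps del: add_bit_eq_xor mult_bit_eq_and)
  show "x * y * z = x * (y * z)" "(x + y) * z = x * z + y * z"
    by (simp_all add: defs algebra_simps del: add_bit_eq_xor mult_bit_eq_and)
  show "inverse x * x = 1" if "x \<noteq> 0"
    using that by (cases a; cases b) (simp_all add: defs)
qed

end

definition omega :: gf4 where
  "omega = GF4 0 1"

lemma omega_squared: "omega\<^sup>2 = omega + 1"
  by (simp add: omega_def one_gf4_def power2_eq_square)

lemma UNIV_gf4: "(UNIV :: gf4 set) = {0, 1, omega, omega\<^sup>2}"
proof -
  have "x \<in> {0, 1, omega, omega\<^sup>2}" for x
  proof (cases x)
    case (GF4 a b)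
    then show ?thesis
      by (cases a; cases b)
        (simp_all add: omega_def zero_gf4_def one_gf4_def power2_eq_square)
  qed
  then show ?thesis by blast
qed

instance gf4 :: finite
  by standard (simp add: UNIV_gf4)

lemma card_gf4: "CARD(gf4) = 4"
  by (simp add: UNIV_gf4 omega_def zero_gf4_def one_gf4_def power2_eq_square)

definition conj_gf4 :: "gf4 \<Rightarrow> gf4" where
  "conj_gf4 x = x\<^sup>2"

definition trace_gf4 :: "gf4 \<Rightarrow> gf4" where
  "trace_gf4 x = x + conj_gf4 x"

definition hamming_weight :: "gf4 ^ 'n::finite \<Rightarrow> nat" where
  "hamming_weight u = card {i. u $ i \<noteq> 0}"

definition is_additive_subgroup :: "'a::group_add set \<Rightarrow> bool" where
  "is_additive_subgroup C \<longleftrightarrow>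
     0 \<in> C \<and> (\<forall>u\<in>C. \<forall>v\<in>C. u + v \<in> C) \<and> (\<forall>u\<in>C. - u \<in> C)"

definition minimum_weight :: "(gf4 ^ 'n::finite) set \<Rightarrow> nat" where
  "minimum_weight C = Min (hamming_weight ` (C - {0}))"

(* additive (n, 2^k, d) code, where n = CARD('n); the minimum of the empty set is
   unspecified, so a code without nonzero words has no minimum weight. *)
definition additive_code :: "nat \<Rightarrow> nat \<Rightarrow> (gf4 ^ 'n::finite) set \<Rightarrow> bool" where
  "additive_code k d C \<longleftrightarrow>
     is_additive_subgroup C \<and> card C = 2 ^ k \<and> C \<noteq> {0} \<and> minimum_weight C = d"

definition weight_count :: "(gf4 ^ 'n::finite) set \<Rightarrow> nat \<Rightarrow> nat" where
  "weight_count C i = card {c \<in> C. hamming_weight c = i}"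

(* A polynomial in x whose coefficients are polynomials in y. *)
definition weight_enumerator :: "(gf4 ^ 'n::finite) set \<Rightarrow> int poly poly" where
  "weight_enumerator C =
     (\<Sum>i\<le>CARD('n). monom (monom (int (weight_count C i)) i) (CARD('n) - i))"

definition dual_code :: "(gf4 ^ 'n::finite) set \<Rightarrow> (gf4 ^ 'n) set" where
  "dual_code C = {u. \<forall>c\<in>C. (\<Sum>i\<in>UNIV. trace_gf4 (u $ i * conj_gf4 (c $ i))) = 0}"

definition formally_self_dual :: "(gf4 ^ 'n::finite) set \<Rightarrow> bool" where
  "formally_self_dual C \<longleftrightarrow> weight_enumerator C = weight_enumerator (dual_code C)"

definition permute_coords :: "('n \<Rightarrow> 'n) \<Rightarrow> gf4 ^ 'n::finite \<Rightarrow> gf4 ^ 'n" where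
  "permute_coords p u = (\<chi> i. u $ p i)"

definition scale_coords :: "gf4 ^ 'n::finite \<Rightarrow> gf4 ^ 'n \<Rightarrow> gf4 ^ 'n" where
  "scale_coords a u = (\<chi> i. a $ i * u $ i)"

definition conj_coords :: "'n set \<Rightarrow> gf4 ^ 'n::finite \<Rightarrow> gf4 ^ 'n" where
  "conj_coords S u = (\<chi> i. if i \<in> S then conj_gf4 (u $ i) else u $ i)"

definition code_maps :: "(gf4 ^ 'n::finite \<Rightarrow> gf4 ^ 'n) set" where
  "code_maps = {conj_coords S \<circ> scale_coords a \<circ> permute_coords p | S a p.
     (\<forall>i. a $ i \<noteq> 0) \<and> bij p}"

definition equivalent_codes :: "(gf4 ^ 'n::finite) set \<Rightarrow> (gf4 ^ 'n) set \<Rightarrow> bool" where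
  "equivalent_codes C D \<longleftrightarrow> (\<exists>f\<in>code_maps. f ` C = D)"

definition automorphism_group :: "(gf4 ^ 'n::finite) set \<Rightarrow> (gf4 ^ 'n \<Rightarrow> gf4 ^ 'n) set" where
  "automorphism_group C = {f \<in> code_maps. f ` C = C}"

(* The coefficient lists, from the constant term upwards, of W(1, y). *)
definition W_11_1 :: "int poly" where
  "W_11_1 = [:1, 0, 0, 0, 0, 55, 242, 275, 495, 605, 286, 89:]"

definition W_11_2 :: "int poly" where
  "W_11_2 = [:1, 0, 0, 0, 0, 66, 198, 330, 495, 550, 330, 78:]"

definition W_11_3 :: "int poly" where
  "W_11_3 = [:1, 0, 0, 0, 0, 70, 182, 350, 495, 530, 346, 74:]"

definition W_11_4 :: "int poly" where
  "W_11_4 = [:1, 0, 0, 0, 0, 75, 162, 375, 495, 505, 366, 69:]"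

definition W_11_5 :: "int poly" where
  "W_11_5 = [:1, 0, 0, 0, 0, 77, 154, 385, 495, 495, 374, 67:]"

(* W(1, y): the outer variable x is set to 1. *)
definition codes_with ::
  "(gf4 ^ 'n::finite) set set \<Rightarrow> int poly \<Rightarrow> (gf4 ^ 'n) set set" where
  "codes_with \<S> W = {C \<in> \<S>. poly (weight_enumerator C) 1 = W}"

definition codes_with_aut ::
  "(gf4 ^ 'n::finite) set set \<Rightarrow> int poly \<Rightarrow> nat \<Rightarrow> (gf4 ^ 'n) set set" where
  "codes_with_aut \<S> W m = {C \<in> codes_with \<S> W. card (automorphism_group C) = m}"

end

theory Submission
  imports Defs
begin

text \<open>
The codes are graph codes: for a 0/1 matrix \<open>A\<close>, the additive span of the rows of
\<open>A + \<omega> I\<close>. The dual of such a code is the graph code of the transpose. For \<open>A\<close> circulant, or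
circulant with a border of ones, reversing the (first ten) coordinates transposes \<open>A\<close>, hence the
code is formally self-dual. Its weights are found by enumeration.

An automorphism permutes the words of weight 5, so the permutation of the coordinates it induces
preserves the number of words of weight 5 that are nonzero at three given coordinates, and the sum
over the nonzero \<open>x\<close> of the squared number of such words with entry \<open>x\<close> at a given
coordinate. A backtracking search finds the permutations that preserve these numbers and fix
coordinate 0; rotations of the matrix account for the orbit of 0. All permutations found this way
come from automorphisms. The automorphism is determined by its permutation, since distinct words of
weight 5 have distinct supports and every coordinate takes two nonzero values on them.
A number computed from the same invariants tells the 21 codes apart.
\<close>

section \<open>Monomial maps\<close>

fun re :: "gf4 \<Rightarrow> bit" where "re (GF4 a b) = a"

fun im :: "gf4 \<Rightarrow> bit" where "im (GF4 a b) = b"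

lemma gf4_eq_iff: "x = y \<longleftrightarrow> re x = re y \<and> im x = im y"
  by (cases x; cases y) simp

lemma re_add [simp]: "re (x + y) = re x + re y"
  and im_add [simp]: "im (x + y) = im x + im y"
  by (cases x; cases y; simp del: add_bit_eq_xor)+

lemma re_im_zero [simp]: "re 0 = 0" "im 0 = 0"
  by (simp_all add: zero_gf4_def)

lemma re_sum: "re (sum f S) = (\<Sum>x\<in>S. re (f x))"
  and im_sum: "im (sum f S) = (\<Sum>x\<in>S. im (f x))"
  by (induction S rule: infinite_finite_induct; simp del: add_bit_eq_xor)+

text \<open>In the basis 1, omega the trace form becomes the standard symplectic form over GF(2).
  This turns duality into linear equations between bits.\<close>

lemma trace_mult_conj: "trace_gf4 (x * conj_gf4 y) = GF4 (re x * im y + im x * re y) 0"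
proof -
  obtain a b c d where "x = GF4 a b" "y = GF4 c d" by (metis gf4.exhaust)
  then show ?thesis
    by (cases a; cases b; cases c; cases d)
      (simp_all add: trace_gf4_def conj_gf4_def power2_eq_square)
qed

lemma conj_conj [simp]: "conj_gf4 (conj_gf4 x) = x"
proof -
  obtain a b where "x = GF4 a b" by (metis gf4.exhaust)
  then show ?thesis
    by (cases a; cases b) (simp_all add: conj_gf4_def power2_eq_square)
qed

lemma conj_mult: "conj_gf4 (x * y) = conj_gf4 x * conj_gf4 y"
  by (simp add: conj_gf4_def power_mult_distrib)

lemma conj_eq_0_iff [simp]: "conj_gf4 x = 0 \<longleftrightarrow> x = 0"
  by (simp add: conj_gf4_def)

lemma conj_add: "conj_gf4 (x + y) = conj_gf4 x + conj_gf4 y"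
proof -
  obtain a b c d where "x = GF4 a b" "y = GF4 c d" by (metis gf4.exhaust)
  then show ?thesis
    by (cases a; cases b; cases c; cases d) (simp_all add: conj_gf4_def power2_eq_square)
qed

text \<open>These are the six maps that a code map can apply at one coordinate. They are additive,
  fix 0 and induce all permutations of the three nonzero elements.\<close>

definition local_map :: "(gf4 \<Rightarrow> gf4) \<Rightarrow> bool" where
  "local_map s \<longleftrightarrow> (\<exists>a. a \<noteq> 0 \<and> (s = (\<lambda>x. a * x) \<or> s = (\<lambda>x. conj_gf4 (a * x))))"

lemma local_map_id: "local_map (\<lambda>x. x)"
  unfolding local_map_def by (rule exI[of _ 1]) (auto simp: fun_eq_iff)

lemma local_map_add: "local_map s \<Longrightarrow> s (x + y) = s x + s y"
  by (auto simp: local_map_def distrib_left conj_add)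

lemma local_map_eq_0_iff: "local_map s \<Longrightarrow> s x = 0 \<longleftrightarrow> x = 0"
  by (auto simp: local_map_def)

lemma local_map_inj: "local_map s \<Longrightarrow> inj s"
  unfolding local_map_def inj_def by (metis conj_conj mult_cancel_left)

lemma local_map_bij: "local_map s \<Longrightarrow> bij s"
  by (simp add: bij_def finite_UNIV_inj_surj local_map_inj)

lemma local_map_comp:
  assumes "local_map s" "local_map t"
  shows "local_map (\<lambda>x. s (t x))"
proof -
  obtain a where a: "a \<noteq> 0" "s = (\<lambda>x. a * x) \<or> s = (\<lambda>x. conj_gf4 (a * x))"
    using assms(1) by (auto simp: local_map_def)
  obtain b where b: "b \<noteq> 0" "t = (\<lambda>x. b * x) \<or> t = (\<lambda>x. conj_gf4 (b * x))"
    using assms(2) by (auto simp: local_map_def)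
  \<comment> \<open>A scalar is conjugated when it passes through a conjugation:
    \<open>a * conj_gf4 (b * x)\<close> equals \<open>conj_gf4 (conj_gf4 a * b * x)\<close>. So the
    composite has the factor \<open>conj_gf4 a * b\<close> whenever the inner map
    conjugates.\<close>
  have ab: "a * b \<noteq> 0" and ab': "conj_gf4 a * b \<noteq> 0" using a b by auto
  from a(2) b(2) show ?thesis
  proof (elim disjE)
    assume "s = (\<lambda>x. a * x)" "t = (\<lambda>x. b * x)"
    then show ?thesis unfolding local_map_def using ab
      by (intro exI[of _ "a * b"]) (auto simp: mult.assoc)
  next
    assume "s = (\<lambda>x. a * x)" "t = (\<lambda>x. conj_gf4 (b * x))"
    then show ?thesis unfolding local_map_def using ab'
      by (intro exI[of _ "conj_gf4 a * b"]) (auto simp: mult.assoc conj_mult)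
  next
    assume "s = (\<lambda>x. conj_gf4 (a * x))" "t = (\<lambda>x. b * x)"
    then show ?thesis unfolding local_map_def using ab
      by (intro exI[of _ "a * b"]) (auto simp: mult.assoc)
  next
    assume "s = (\<lambda>x. conj_gf4 (a * x))" "t = (\<lambda>x. conj_gf4 (b * x))"
    then show ?thesis unfolding local_map_def using ab'
      by (intro exI[of _ "conj_gf4 a * b"]) (auto simp: mult.assoc conj_mult)
  qed
qed

text \<open>One form for permutation, scaling and conjugation together. Coordinate \<open>i\<close>
  of the image is read off at \<open>p i\<close>, hence permutations compose in reverse
  order.\<close>

definition monomial :: "('n \<Rightarrow> 'n) \<Rightarrow> ('n \<Rightarrow> gf4 \<Rightarrow> gf4) \<Rightarrow> gf4 ^ 'n::finite \<Rightarrow> gf4 ^ 'n" where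
  "monomial p s u = (\<chi> i. s i (u $ p i))"

lemma monomial_nth [simp]: "monomial p s u $ i = s i (u $ p i)"
  by (simp add: monomial_def)

lemma code_maps_monomial:
  "code_maps = {monomial p s | p s. bij p \<and> (\<forall>i. local_map (s i))}"
proof (intro equalityI subsetI)
  fix f :: "gf4 ^ 'a \<Rightarrow> gf4 ^ 'a" assume "f \<in> code_maps"
  then obtain S a p where f: "f = conj_coords S \<circ> scale_coords a \<circ> permute_coords p"
    and a: "\<forall>i. a $ i \<noteq> 0" and p: "bij p"
    by (auto simp: code_maps_def)
  define s where "s i = (if i \<in> S then (\<lambda>x. conj_gf4 (a $ i * x)) else (\<lambda>x. a $ i * x))" for i
  have "f = monomial p s"
    by (simp add: f fun_eq_iff vec_eq_iff conj_coords_def scale_coords_def permute_coords_def s_def)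
  moreover have "local_map (s i)" for i
    using a by (auto simp: s_def local_map_def)
  ultimately show "f \<in> {monomial p s | p s. bij p \<and> (\<forall>i. local_map (s i))}"
    using p by auto
next
  fix f :: "gf4 ^ 'a \<Rightarrow> gf4 ^ 'a"
  assume "f \<in> {monomial p s | p s. bij p \<and> (\<forall>i. local_map (s i))}"
  then obtain p s where f: "f = monomial p s" and p: "bij p" and s: "\<And>i. local_map (s i)"
    by auto
  obtain a where a: "\<And>i. a i \<noteq> 0" "\<And>i. s i = (\<lambda>x. a i * x) \<or> s i = (\<lambda>x. conj_gf4 (a i * x))"
    using s unfolding local_map_def by metis
  \<comment> \<open>The two alternatives for \<open>s i\<close> are resolved by taking
    multiplication wherever it fits; on the remaining coordinates the conjugated form must
    hold.\<close>
  define S where "S = {i. s i \<noteq> (\<lambda>x. a i * x)}"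
  have "s i x = (if i \<in> S then conj_gf4 (a i * x) else a i * x)" for i x
    using a(2)[of i] by (auto simp: S_def)
  then have "f = conj_coords S \<circ> scale_coords (\<chi> i. a i) \<circ> permute_coords p"
    by (simp add: f fun_eq_iff vec_eq_iff conj_coords_def scale_coords_def permute_coords_def)
  moreover have "\<forall>i. (\<chi> i. a i) $ i \<noteq> 0" using a(1) by simp
  ultimately show "f \<in> code_maps" using p unfolding code_maps_def by blast
qed

lemma inj_monomial:
  assumes "bij p" "\<And>i. local_map (s i)"
  shows "inj (monomial p s)"
proof (rule injI)
  fix u v assume eq: "monomial p s u = monomial p s v"
  have "u $ p i = v $ p i" for i
    using eq local_map_inj[OF assms(2)[of i]] by (metis injD monomial_nth)
  then have "u $ j = v $ j" for j
    using assms(1) by (metis bij_pointE)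
  then show "u = v" by (simp add: vec_eq_iff)
qed

lemma card_preimage_bij: "bij p \<Longrightarrow> card {i. P (p i)} = card {i. P i}"
  by (rule bij_betw_same_card[of p], rule bij_betwI[of _ _ _ "inv p"])
    (auto simp: bij_is_inj bij_is_surj surj_f_inv_f)

lemma hamming_weight_monomial:
  assumes "bij p" "\<And>i. local_map (s i)"
  shows "hamming_weight (monomial p s u) = hamming_weight u"
  using card_preimage_bij[OF assms(1), of "\<lambda>i. u $ i \<noteq> 0"]
  by (simp add: hamming_weight_def local_map_eq_0_iff[OF assms(2)])

section \<open>Invariants of the words of a given weight\<close>

definition words_of_weight :: "nat \<Rightarrow> (gf4 ^ 'n::finite) set \<Rightarrow> (gf4 ^ 'n) set" where
  "words_of_weight d C = {c \<in> C. hamming_weight c = d}"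

definition through :: "nat \<Rightarrow> (gf4 ^ 'n::finite) set \<Rightarrow> 'n \<Rightarrow> 'n \<Rightarrow> 'n \<Rightarrow> nat" where
  "through d C i j k = card {c \<in> words_of_weight d C. c $ i \<noteq> 0 \<and> c $ j \<noteq> 0 \<and> c $ k \<noteq> 0}"

text \<open>The single counts are not invariant, because a local map may permute the nonzero
  elements. A symmetric function of the three counts is.\<close>

definition spread :: "nat \<Rightarrow> (gf4 ^ 'n::finite) set \<Rightarrow> 'n \<Rightarrow> int" where
  "spread d C i = (\<Sum>x\<in>UNIV - {0}. (int (card {c \<in> words_of_weight d C. c $ i = x}))\<^sup>2)"

text \<open>With squares in place of cubes, two of the codes below would have the same signature.\<close>

definition signature :: "nat \<Rightarrow> (gf4 ^ 'n::finite) set \<Rightarrow> int" where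
  "signature d C = (\<Sum>i\<in>UNIV. spread d C i) + (\<Sum>i\<in>UNIV. \<Sum>j\<in>UNIV. (int (through d C i i j)) ^ 3)"

context
  fixes p :: "'n::finite \<Rightarrow> 'n" and s :: "'n \<Rightarrow> gf4 \<Rightarrow> gf4"
  assumes p: "bij p" and s: "\<And>i. local_map (s i)"
begin

lemma words_of_weight_image:
  "words_of_weight d (monomial p s ` C) = monomial p s ` words_of_weight d C"
  by (auto simp: words_of_weight_def hamming_weight_monomial[OF p s])

lemma card_words_image:
  "card {c \<in> words_of_weight d (monomial p s ` C). P c} =
    card {c \<in> words_of_weight d C. P (monomial p s c)}"
proof -
  have "{c \<in> words_of_weight d (monomial p s ` C). P c} =
    monomial p s ` {c \<in> words_of_weight d C. P (monomial p s c)}"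
    by (auto simp: words_of_weight_image)
  then show ?thesis
    by (simp add: card_image inj_on_subset[OF inj_monomial[OF p s]])
qed

lemma through_image: "through d (monomial p s ` C) i j k = through d C (p i) (p j) (p k)"
  by (simp add: through_def card_words_image local_map_eq_0_iff[OF s])

text \<open>The map \<open>s i\<close> permutes the nonzero elements, so the three counts at
  \<open>i\<close> in the image are those at \<open>p i\<close> in another order.\<close>

lemma spread_image: "spread d (monomial p s ` C) i = spread d C (p i)"
proof -
  have "bij_betw (s i) (UNIV - {0}) (UNIV - {0})"
    using local_map_bij[OF s[of i]] local_map_eq_0_iff[OF s[of i], of 0]
    by (auto simp: bij_betw_def bij_def image_set_diff intro: inj_on_subset)
  then have "spread d (monomial p s ` C) i =
    (\<Sum>x\<in>UNIV - {0}. (int (card {c \<in> words_of_weight d (monomial p s ` C). c $ i = s i x}))\<^sup>2)"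
    unfolding spread_def by (rule sum.reindex_bij_betw[symmetric])
  also have "\<dots> = spread d C (p i)"
    by (simp add: spread_def card_words_image inj_eq[OF local_map_inj[OF s]])
  finally show ?thesis .
qed

lemma signature_image: "signature d (monomial p s ` C) = signature d C"
proof -
  have "(\<Sum>i\<in>UNIV. spread d C (p i)) = (\<Sum>i\<in>UNIV. spread d C i)"
    by (rule sum.reindex_bij_betw[OF p])
  moreover have "(\<Sum>i\<in>UNIV. \<Sum>j\<in>UNIV. (int (through d C (p i) (p i) (p j))) ^ 3) =
    (\<Sum>i\<in>UNIV. \<Sum>j\<in>UNIV. (int (through d C i i j)) ^ 3)"
    by (subst sum.reindex_bij_betw[OF p, of "\<lambda>i. \<Sum>j\<in>UNIV. (int (through d C i i (p j))) ^ 3"])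
      (simp add: sum.reindex_bij_betw[OF p, of "\<lambda>j. (int (through d C i i j)) ^ 3" for i])
  ultimately show ?thesis
    by (simp add: signature_def spread_image through_image)
qed

end

lemma equivalent_codes_signature: "equivalent_codes C D \<Longrightarrow> signature d C = signature d D"
  by (auto simp: equivalent_codes_def code_maps_monomial signature_image)

section \<open>Automorphisms through the coordinate permutations they induce\<close>

definition aut_perms :: "(gf4 ^ 'n::finite) set \<Rightarrow> ('n \<Rightarrow> 'n) set" where
  "aut_perms C = {p. bij p \<and> (\<exists>s. (\<forall>i. local_map (s i)) \<and> monomial p s ` C = C)}"

lemma aut_perms_comp:
  assumes "p \<in> aut_perms C" "q \<in> aut_perms C"
  shows "q \<circ> p \<in> aut_perms C"
proof -
  obtain s t where s: "\<And>i. local_map (s i)" "monomial p s ` C = C"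
    and t: "\<And>i. local_map (t i)" "monomial q t ` C = C"
    using assms by (auto simp: aut_perms_def)
  \<comment> \<open>The inner map is read at coordinate \<open>p i\<close>, so this is where its
    local map is taken.\<close>
  define r where "r i x = s i (t (p i) x)" for i x
  have eq: "monomial (q \<circ> p) r = monomial p s \<circ> monomial q t"
    by (simp add: fun_eq_iff vec_eq_iff r_def)
  have "local_map (r i)" for i
    unfolding r_def[abs_def] by (rule local_map_comp[OF s(1) t(1)])
  moreover have "monomial (q \<circ> p) r ` C = C"
    unfolding eq image_comp[symmetric] using s t by simp
  moreover have "bij (q \<circ> p)" using assms by (auto simp: aut_perms_def intro: bij_comp)
  ultimately show ?thesis by (auto simp: aut_perms_def)
qed

lemma
  assumes "p \<in> aut_perms C"
  shows aut_perms_through: "through d C (p i) (p j) (p k) = through d C i j k"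
    and aut_perms_spread: "spread d C (p i) = spread d C i"
proof -
  obtain s where "bij p" "\<And>i. local_map (s i)" "monomial p s ` C = C"
    using assms by (auto simp: aut_perms_def)
  then show "through d C (p i) (p j) (p k) = through d C i j k" "spread d C (p i) = spread d C i"
    by (metis through_image, metis spread_image)
qed

text \<open>The two maps send a word of weight d to words of weight d with the same support, hence
  to the same word. So \<open>s i\<close> and \<open>t i\<close> agree at two distinct nonzero
  elements, and these generate GF(4) additively.\<close>

lemma monomial_unique:
  assumes supports: "inj_on (\<lambda>c. {i. c $ i \<noteq> 0}) (words_of_weight d C)"
    and varied: "\<And>i. \<exists>c\<in>words_of_weight d C. \<exists>c'\<in>words_of_weight d C.
      c $ i \<noteq> 0 \<and> c' $ i \<noteq> 0 \<and> c $ i \<noteq> c' $ i"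
    and p: "bij p" and s: "\<And>i. local_map (s i)" and t: "\<And>i. local_map (t i)"
    and C: "monomial p s ` C = C" "monomial p t ` C = C"
  shows "s = t"
proof (rule ext)
  fix i
  have agree: "s i (c $ p i) = t i (c $ p i)" if "c \<in> words_of_weight d C" for c
  proof -
    have "monomial p s c \<in> words_of_weight d C" "monomial p t c \<in> words_of_weight d C"
      using that words_of_weight_image[where p = p and s = s and d = d and C = C, OF p s]
        words_of_weight_image[where p = p and s = t and d = d and C = C, OF p t] C by auto
    moreover have "{i. monomial p s c $ i \<noteq> 0} = {i. monomial p t c $ i \<noteq> 0}"
      by (simp add: local_map_eq_0_iff[OF s] local_map_eq_0_iff[OF t])
    ultimately have "monomial p s c = monomial p t c"
      by (intro inj_onD[OF supports]) auto
    then show ?thesis by (metis monomial_nth)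
  qed
  obtain c c' where c: "c \<in> words_of_weight d C" "c' \<in> words_of_weight d C"
    "c $ p i \<noteq> 0" "c' $ p i \<noteq> 0" "c $ p i \<noteq> c' $ p i"
    using varied[of "p i"] by auto
  let ?a = "c $ p i" and ?b = "c' $ p i"
  have all: "x \<in> {0, ?a, ?b, ?a + ?b}" for x
  proof -
    have "x \<in> {0, a, b, a + b}" if "a \<noteq> 0" "b \<noteq> 0" "a \<noteq> b" for a b
    proof -
      \<comment> \<open>In characteristic 2 distinct elements have a nonzero sum, so the four listed
        elements are distinct and exhaust the field by counting.\<close>
      have "a + b \<noteq> 0" using that by (metis add_eq_0_iff uminus_gf4_def)
      with that have "card {0, a, b, a + b} = CARD(gf4)" by (simp add: card_gf4)
      then have "{0, a, b, a + b} = UNIV" by (intro card_subset_eq) simp_all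
      then show ?thesis by blast
    qed
    with c show ?thesis by blast
  qed
  show "s i = t i"
  proof
    fix x
    have "s i 0 = t i 0" using local_map_eq_0_iff[OF s, of i 0] local_map_eq_0_iff[OF t, of i 0] by simp
    then show "s i x = t i x"
      using all[of x] agree[OF c(1)] agree[OF c(2)] local_map_add[OF s, of i] local_map_add[OF t, of i]
      by auto
  qed
qed

text \<open>Choosing local maps for each permutation gives a bijection onto the automorphism group.
  It is surjective by \<open>monomial_unique\<close>.\<close>

lemma card_automorphism_group:
  assumes supports: "inj_on (\<lambda>c. {i. c $ i \<noteq> 0}) (words_of_weight d C)"
    and varied: "\<And>i. \<exists>c\<in>words_of_weight d C. \<exists>c'\<in>words_of_weight d C.
      c $ i \<noteq> 0 \<and> c' $ i \<noteq> 0 \<and> c $ i \<noteq> c' $ i"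
  shows "card (automorphism_group C) = card (aut_perms C)"
proof -
  define s where "s p = (SOME s. (\<forall>i. local_map (s i)) \<and> monomial p s ` C = C)" for p
  have ex: "\<exists>s. (\<forall>i. local_map (s i)) \<and> monomial p s ` C = C" if "p \<in> aut_perms C" for p
    using that by (simp add: aut_perms_def)
  have s: "local_map (s p i)" "monomial p (s p) ` C = C" if "p \<in> aut_perms C" for p i
    using someI_ex[OF ex[OF that]] by (simp_all add: s_def)
  have bij: "bij p" if "p \<in> aut_perms C" for p using that by (simp add: aut_perms_def)
  obtain c where c: "c \<in> words_of_weight d C" using varied by blast
  have "inj_on (\<lambda>p. monomial p (s p)) (aut_perms C)"
  proof (rule inj_onI)
    fix p q assume pq: "p \<in> aut_perms C" "q \<in> aut_perms C" and eq: "monomial p (s p) = monomial q (s q)"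
    show "p = q"
    proof (rule ccontr)
      assume "p \<noteq> q"
      then obtain i where i: "p i \<noteq> q i" by auto
      \<comment> \<open>The unit vector at \<open>p i\<close> separates the two maps: at coordinate
        \<open>i\<close> one gives a nonzero value and the other 0.\<close>
      let ?u = "\<chi> j. if j = p i then 1 else (0 :: gf4)"
      have "s p i (?u $ p i) = s q i (?u $ q i)"
        using fun_cong[OF eq, of ?u] by (metis monomial_nth)
      then have "s p i 1 = s q i 0" using i by simp
      then show False
        using local_map_eq_0_iff[OF s(1)[OF pq(1)], of i 1]
          local_map_eq_0_iff[OF s(1)[OF pq(2)], of i 0] by simp
    qed
  qed
  moreover have "(\<lambda>p. monomial p (s p)) ` aut_perms C = automorphism_group C"
  proof (intro equalityI subsetI)
    fix f assume "f \<in> (\<lambda>p. monomial p (s p)) ` aut_perms C"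
    then obtain p where p: "p \<in> aut_perms C" "f = monomial p (s p)" by auto
    then show "f \<in> automorphism_group C"
      unfolding automorphism_group_def code_maps_monomial using s[of p] bij[OF p(1)] by blast
  next
    fix f assume "f \<in> automorphism_group C"
    then obtain p t where f: "f = monomial p t" "bij p" "\<And>i. local_map (t i)" "monomial p t ` C = C"
      by (auto simp: automorphism_group_def code_maps_monomial)
    then have p: "p \<in> aut_perms C" by (auto simp: aut_perms_def)
    have "t = s p"
      by (rule monomial_unique[OF supports varied f(2,3) s(1)[OF p] f(4) s(2)[OF p]])
    with f p show "f \<in> (\<lambda>p. monomial p (s p)) ` aut_perms C" by blast
  qed
  ultimately show ?thesis by (metis card_image)
qed

text \<open>
If \<open>R\<close> moves the orbit of \<open>b\<close> back to \<open>b\<close>, then the group \<open>P\<close> is \<open>R\<^sup>-\<^sup>1\<close> times the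
stabilizer of \<open>b\<close>.
\<close>

lemma card_orbit_stabilizer:
  fixes P :: "('n::finite \<Rightarrow> 'n) set"
  assumes P: "\<And>p. p \<in> P \<Longrightarrow> bij p" "\<And>p q. p \<in> P \<Longrightarrow> q \<in> P \<Longrightarrow> q \<circ> p \<in> P"
    and R: "R \<subseteq> P" "inj_on (\<lambda>r. r b) R"
    and S: "S \<subseteq> P" "\<And>p. p \<in> P \<Longrightarrow> p b = b \<Longrightarrow> p \<in> S" "\<And>p. p \<in> S \<Longrightarrow> p b = b"
    and cover: "\<And>p. p \<in> P \<Longrightarrow> \<exists>r\<in>R. r (p b) = b"
  shows "card P = card R * card S"
proof (rule antisym)
  have "P \<subseteq> (\<lambda>(r, q). inv r \<circ> q) ` (R \<times> S)"
  proof
    fix p assume p: "p \<in> P"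
    obtain r where r: "r \<in> R" "r (p b) = b" using cover[OF p] by auto
    have "r \<circ> p \<in> S" using S(2)[of "r \<circ> p"] P(2)[OF p] r R(1) by auto
    moreover have "p = inv r \<circ> (r \<circ> p)"
      using P(1)[of r] r(1) R(1) by (auto simp: fun_eq_iff bij_is_inj)
    ultimately show "p \<in> (\<lambda>(r, q). inv r \<circ> q) ` (R \<times> S)"
      using r(1) by (intro image_eqI[of _ _ "(r, r \<circ> p)"]) auto
  qed
  then have "card P \<le> card ((\<lambda>(r, q). inv r \<circ> q) ` (R \<times> S))" by (rule card_mono[rotated]) simp
  also have "\<dots> \<le> card (R \<times> S)" by (rule card_image_le) simp
  finally show "card P \<le> card R * card S" by (simp add: card_cartesian_product)
next
  \<comment> \<open>The lower bound counts products with \<open>r\<close> itself instead of its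
    inverse: they lie in \<open>P\<close> by closure under composition, and their value at
    \<open>b\<close> determines \<open>r\<close>.\<close>
  have "inj_on (\<lambda>(r, q). r \<circ> q) (R \<times> S)"
  proof (rule inj_onI, clarify)
    fix r q r' q' assume *: "r \<in> R" "q \<in> S" "r' \<in> R" "q' \<in> S" "r \<circ> q = r' \<circ> q'"
    then have "r b = r' b" using S(3) by (metis comp_apply)
    then have r: "r = r'" using R(2) * by (auto dest: inj_onD)
    have "inj r" using P(1)[of r] R(1) * by (auto dest: bij_is_inj)
    then have "q = q'" using *(5) r by (auto simp: fun_eq_iff dest: injD)
    with r show "r = r' \<and> q = q'" by simp
  qed
  moreover have "(\<lambda>(r, q). r \<circ> q) ` (R \<times> S) \<subseteq> P" using P(2) R(1) S(1) by auto
  ultimately have "card (R \<times> S) \<le> card P" by (rule card_inj_on_le) simp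
  then show "card R * card S \<le> card P" by (simp add: card_cartesian_product)
qed

section \<open>Graph codes\<close>

declare add_bit_eq_xor [simp del] mult_bit_eq_and [simp del]

text \<open>The row span of A + omega I, given by equations: the omega-part of a word is an
  arbitrary bit vector b, and its other part is b A. In this form membership of an image is a
  reindexing of sums.\<close>

definition graph_code :: "('n \<Rightarrow> 'n \<Rightarrow> bool) \<Rightarrow> (gf4 ^ 'n::finite) set" where
  "graph_code A = {u. \<forall>i. re (u $ i) = (\<Sum>j\<in>UNIV. im (u $ j) * of_bool (A j i))}"

lemma graph_codeI:
  "(\<And>i. re (u $ i) = (\<Sum>j\<in>UNIV. im (u $ j) * of_bool (A j i))) \<Longrightarrow> u \<in> graph_code A"
  by (simp add: graph_code_def)

lemma graph_codeD:
  "u \<in> graph_code A \<Longrightarrow> re (u $ i) = (\<Sum>j\<in>UNIV. im (u $ j) * of_bool (A j i))"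
  by (simp add: graph_code_def)

lemma zero_in_graph_code: "0 \<in> graph_code A"
  by (rule graph_codeI) simp

lemma graph_code_add: "u \<in> graph_code A \<Longrightarrow> v \<in> graph_code A \<Longrightarrow> u + v \<in> graph_code A"
  by (rule graph_codeI) (simp add: graph_codeD distrib_right sum.distrib)

lemma graph_code_subgroup:
  "is_additive_subgroup (graph_code (A :: 'n::finite \<Rightarrow> 'n \<Rightarrow> bool))"
proof -
  have "- u = u" for u :: "gf4 ^ 'n" by (simp add: vec_eq_iff uminus_gf4_def)
  then show ?thesis
    by (auto simp only: is_additive_subgroup_def zero_in_graph_code graph_code_add)
qed

text \<open>The omega-part of a codeword is arbitrary and determines the word.\<close>

lemma card_graph_code: "card (graph_code (A :: 'n::finite \<Rightarrow> 'n \<Rightarrow> bool)) = 2 ^ CARD('n)"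
proof -
  let ?f = "\<lambda>(u :: gf4 ^ 'n) i. im (u $ i)"
  let ?g = "\<lambda>b. (\<chi> i. GF4 (\<Sum>j\<in>UNIV. b j * of_bool (A j i)) (b i)) :: gf4 ^ 'n"
  have "bij_betw ?f (graph_code A) UNIV"
    by (rule bij_betwI[of _ _ _ ?g])
      (auto simp: vec_eq_iff gf4_eq_iff graph_codeD intro!: graph_codeI)
  then have "card (graph_code A) = CARD('n \<Rightarrow> bit)" by (rule bij_betw_same_card)
  moreover have "x \<in> {0, 1}" for x :: bit by (cases x) simp_all
  then have "(UNIV :: bit set) = {0, 1}" by blast
  then have "CARD(bit) = card {0, 1 :: bit}" by (rule arg_cong)
  then have "CARD(bit) = 2" by simp
  ultimately show ?thesis by (simp add: card_fun)
qed

definition graph_row :: "('n \<Rightarrow> 'n \<Rightarrow> bool) \<Rightarrow> 'n \<Rightarrow> gf4 ^ 'n::finite" where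
  "graph_row A j = (\<chi> i. GF4 (of_bool (A j i)) (of_bool (i = j)))"

lemma of_bool_bit: "of_bool (b = 1) = (b :: bit)"
  by (cases b) simp_all

text \<open>This leads from the equations back to generators, which the enumeration needs. The
  coefficients of a combination of rows are its omega-part.\<close>

lemma graph_code_rows:
  "graph_code A = range (\<lambda>b. \<Sum>j\<in>UNIV. if b j then graph_row A j else 0)"
proof -
  have if_nth: "(if P then graph_row A j else 0) $ i =
    GF4 (of_bool P * of_bool (A j i)) (of_bool P * of_bool (i = j))" for P i j
    by (simp add: graph_row_def zero_gf4_def)
  have re_nth: "re ((\<Sum>j\<in>UNIV. if b j then graph_row A j else 0) $ i) =
      (\<Sum>j\<in>UNIV. of_bool (b j) * of_bool (A j i))" for b i
    by (simp only: sum_component re_sum if_nth re.simps)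
  have im_nth: "im ((\<Sum>j\<in>UNIV. if b j then graph_row A j else 0) $ i) = of_bool (b i)" for b i
  proof -
    have "im ((\<Sum>j\<in>UNIV. if b j then graph_row A j else 0) $ i) =
        (\<Sum>j\<in>UNIV. of_bool (b j) * of_bool (i = j))"
      by (simp only: sum_component im_sum if_nth im.simps)
    also have "\<dots> = (\<Sum>j\<in>UNIV. if i = j then of_bool (b j) else 0)"
      by (rule sum.cong) auto
    finally show ?thesis by simp
  qed
  show ?thesis
  proof (intro equalityI subsetI)
    fix u assume "u \<in> graph_code A"
    then have "u = (\<Sum>j\<in>UNIV. if im (u $ j) = 1 then graph_row A j else 0)"
      by (simp only: vec_eq_iff gf4_eq_iff re_nth im_nth of_bool_bit graph_codeD) simp
    then show "u \<in> range (\<lambda>b. \<Sum>j\<in>UNIV. if b j then graph_row A j else 0)"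
      by (rule image_eqI[where x = "\<lambda>j. im (u $ j) = 1"]) simp
  next
    fix u assume "u \<in> range (\<lambda>b. \<Sum>j\<in>UNIV. if b j then graph_row A j else 0)"
    then show "u \<in> graph_code A"
      by (auto simp only: re_nth im_nth intro!: graph_codeI)
  qed
qed

text \<open>Pairing \<open>u\<close> with a codeword \<open>c\<close> gives a combination of the
  check equations of the transposed graph code at \<open>u\<close>, with the omega-part of
  \<open>c\<close> as coefficients. Since that part is arbitrary, the pairing vanishes for all
  \<open>c\<close> exactly when every equation holds.\<close>

lemma dual_graph_code: "dual_code (graph_code A) = graph_code (\<lambda>i j. A j i)"
proof -
  have sum_GF4: "(\<Sum>i\<in>S. GF4 (f i) 0) = GF4 (sum f S) 0" for f and S :: "'a set"
    by (induction S rule: infinite_finite_induct) (simp_all add: zero_gf4_def)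
  have pairing: "(\<Sum>i\<in>UNIV. trace_gf4 (u $ i * conj_gf4 (c $ i))) =
      GF4 (\<Sum>j\<in>UNIV. im (c $ j) * (re (u $ j) + (\<Sum>i\<in>UNIV. im (u $ i) * of_bool (A j i)))) 0"
    if "c \<in> graph_code A" for u c
  proof -
    have "(\<Sum>i\<in>UNIV. im (u $ i) * re (c $ i)) =
      (\<Sum>i\<in>UNIV. \<Sum>j\<in>UNIV. im (c $ j) * (im (u $ i) * of_bool (A j i)))"
      by (simp only: graph_codeD[OF that] sum_distrib_left) (simp only: ac_simps)
    also have "\<dots> = (\<Sum>j\<in>UNIV. im (c $ j) * (\<Sum>i\<in>UNIV. im (u $ i) * of_bool (A j i)))"
      by (subst sum.swap) (simp only: sum_distrib_left)
    finally show ?thesis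
      by (simp add: trace_mult_conj sum_GF4 sum.distrib distrib_left mult.commute)
  qed
  have bit_sum_0: "a + b = 0 \<longleftrightarrow> a = b" for a b :: bit by (cases a; cases b) simp_all
  show ?thesis
  proof (intro equalityI subsetI)
    fix u assume u: "u \<in> dual_code (graph_code A)"
    show "u \<in> graph_code (\<lambda>i j. A j i)"
    proof (rule graph_codeI)
      fix k
      \<comment> \<open>Row \<open>k\<close> has the \<open>k\<close>-th unit vector as omega-part
        and so isolates the \<open>k\<close>-th equation.\<close>
      have row: "graph_row A k \<in> graph_code A"
        by (rule graph_codeI) (simp add: graph_row_def)
      have "GF4 (\<Sum>j\<in>UNIV. im (graph_row A k $ j) *
          (re (u $ j) + (\<Sum>i\<in>UNIV. im (u $ i) * of_bool (A j i)))) 0 = 0"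
        using u row by (simp only: pairing[OF row, symmetric]) (simp add: dual_code_def)
      then have "(\<Sum>j\<in>UNIV. of_bool (j = k) * (re (u $ j) + (\<Sum>i\<in>UNIV. im (u $ i) * of_bool (A j i)))) = 0"
        by (simp only: graph_row_def vec_lambda_beta im.simps zero_gf4_def gf4.inject)
      then show "re (u $ k) = (\<Sum>i\<in>UNIV. im (u $ i) * of_bool (A k i))"
        by (simp add: bit_sum_0)
    qed
  next
    fix u assume "u \<in> graph_code (\<lambda>i j. A j i)"
    then have "re (u $ j) + (\<Sum>i\<in>UNIV. im (u $ i) * of_bool (A j i)) = 0" for j
      by (simp add: bit_sum_0 graph_codeD)
    then show "u \<in> dual_code (graph_code A)"
      by (simp add: dual_code_def pairing zero_gf4_def)
  qed
qed

text \<open>Both codes have the same number of words, so an injective map from one into the other is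
  onto.\<close>

lemma graph_code_isometry:
  assumes "bij p" "\<And>i. local_map (s i)" "\<And>u. u \<in> graph_code A \<Longrightarrow> monomial p s u \<in> graph_code B"
  shows "monomial p s ` graph_code A = graph_code B"
proof (rule card_subset_eq)
  show "card (monomial p s ` graph_code A) = card (graph_code B)"
    by (simp add: card_image inj_on_subset[OF inj_monomial[OF assms(1,2)]] card_graph_code)
qed (use assms(3) in auto)

text \<open>The dual is the graph code of the transpose, and relabelling the coordinates by
  \<open>p\<close> carries it onto the code itself.\<close>

lemma weight_count_dual_graph_code:
  assumes p: "bij p" and A: "\<And>i j. A (p i) (p j) = A j i"
  shows "weight_count (dual_code (graph_code A)) w = weight_count (graph_code A) w"
proof -
  have "monomial p (\<lambda>_ x. x) ` graph_code (\<lambda>i j. A j i) = graph_code A"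
  proof (rule graph_code_isometry[OF p local_map_id], rule graph_codeI)
    fix u i assume "u \<in> graph_code (\<lambda>i j. A j i)"
    then have "re (u $ p i) = (\<Sum>j\<in>UNIV. im (u $ j) * of_bool (A (p i) j))"
      by (rule graph_codeD)
    also have "\<dots> = (\<Sum>j\<in>UNIV. im (u $ p j) * of_bool (A (p i) (p j)))"
      by (rule sum.reindex_bij_betw[OF p, symmetric])
    finally show "re (monomial p (\<lambda>_ x. x) u $ i) =
        (\<Sum>j\<in>UNIV. im (monomial p (\<lambda>_ x. x) u $ j) * of_bool (A j i))"
      by (simp add: A)
  qed
  then show ?thesis
    using card_words_image[OF p local_map_id, of w "graph_code (\<lambda>i j. A j i)" "\<lambda>_. True"]
    by (simp add: weight_count_def dual_graph_code words_of_weight_def)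
qed

lemma graph_automorphism:
  assumes p: "bij p" and A: "\<And>i j. A (p i) (p j) = A i j"
  shows "p \<in> aut_perms (graph_code A)"
proof -
  have "monomial p (\<lambda>_ x. x) ` graph_code A = graph_code A"
  proof (rule graph_code_isometry[OF p local_map_id], rule graph_codeI)
    fix u i assume "u \<in> graph_code A"
    then have "re (u $ p i) = (\<Sum>j\<in>UNIV. im (u $ j) * of_bool (A j (p i)))"
      by (rule graph_codeD)
    also have "\<dots> = (\<Sum>j\<in>UNIV. im (u $ p j) * of_bool (A (p j) (p i)))"
      by (rule sum.reindex_bij_betw[OF p, symmetric])
    finally show "re (monomial p (\<lambda>_ x. x) u $ i) =
        (\<Sum>j\<in>UNIV. im (monomial p (\<lambda>_ x. x) u $ j) * of_bool (A j i))"
      by (simp add: A)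
  qed
  with p local_map_id show ?thesis
    by (auto simp: aut_perms_def intro!: exI[of _ "\<lambda>_ x. x"])
qed

text \<open>
Exchanging 1 and \<open>\<omega>\<close> at all coordinates gives the graph code of the inverse of \<open>A\<close>, which is
here the transpose.
\<close>

lemma graph_anti_automorphism:
  assumes p: "bij p" and A: "\<And>i j. A (p i) (p j) = A j i"
    and orth: "\<And>i k. (\<Sum>j\<in>UNIV. of_bool (A i j) * of_bool (A k j)) = (of_bool (i = k) :: bit)"
  shows "p \<in> aut_perms (graph_code A)"
proof -
  define swap where "swap x = GF4 (im x) (re x)" for x
  \<comment> \<open>\<open>GF4 1 1\<close> is omega^2. Multiplying by it and conjugating sends 1 to
    omega and omega to 1.\<close>
  have "swap = (\<lambda>x. conj_gf4 (GF4 1 1 * x))"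
  proof
    fix x show "swap x = conj_gf4 (GF4 1 1 * x)"
      by (cases "re x"; cases "im x"; cases x)
        (auto simp: swap_def conj_gf4_def power2_eq_square)
  qed
  then have swap: "local_map swap"
    unfolding local_map_def by (intro exI[of _ "GF4 1 1"]) (simp add: zero_gf4_def)
  have "monomial p (\<lambda>_. swap) ` graph_code A = graph_code A"
  proof (rule graph_code_isometry[OF p swap], rule graph_codeI)
    fix u i assume u: "u \<in> graph_code A"
    have "(\<Sum>j\<in>UNIV. re (u $ p j) * of_bool (A j i)) =
      (\<Sum>j\<in>UNIV. re (u $ p j) * of_bool (A (p i) (p j)))" by (simp add: A)
    also have "\<dots> = (\<Sum>j\<in>UNIV. re (u $ j) * of_bool (A (p i) j))"
      by (rule sum.reindex_bij_betw[OF p])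
    also have "\<dots> = (\<Sum>j\<in>UNIV. \<Sum>k\<in>UNIV. im (u $ k) * (of_bool (A k j) * of_bool (A (p i) j)))"
      by (simp only: graph_codeD[OF u] sum_distrib_right mult.assoc)
    also have "\<dots> = (\<Sum>k\<in>UNIV. im (u $ k) * (\<Sum>j\<in>UNIV. of_bool (A k j) * of_bool (A (p i) j)))"
      by (subst sum.swap) (simp only: sum_distrib_left)
    \<comment> \<open>By \<open>orth\<close>, A times its transpose is the identity over GF(2), so
      only the term with \<open>k = p i\<close> survives.\<close>
    also have "\<dots> = im (u $ p i)" by (simp add: orth)
    finally show "re (monomial p (\<lambda>_. swap) u $ i) =
        (\<Sum>j\<in>UNIV. im (monomial p (\<lambda>_. swap) u $ j) * of_bool (A j i))"
      by (simp add: swap_def)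
  qed
  with p swap show ?thesis
    by (auto simp: aut_perms_def intro!: exI[of _ "\<lambda>_. swap"])
qed

section \<open>Evaluation on lists\<close>

text \<open>
The following functions are evaluated by rewriting. They recurse by pattern matching rather than
through abstractions, since rewriting under a binder unfolds recursive functions on symbolic
arguments without end; and they follow the tree of partial sums of generators, since steps on a term
that contains all 2048 words are slow. The symbols stand for \<open>0, 1, \<omega>, \<omega>\<^sup>2\<close>.
\<close>

datatype symbol = Z | I | W | V

fun symbol_add :: "symbol \<Rightarrow> symbol \<Rightarrow> symbol" where
  "symbol_add Z y = y" | "symbol_add x Z = x"
| "symbol_add I I = Z" | "symbol_add I W = V" | "symbol_add I V = W"
| "symbol_add W I = V" | "symbol_add W W = Z" | "symbol_add W V = I"
| "symbol_add V I = W" | "symbol_add V W = I" | "symbol_add V V = Z"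

fun word_add :: "symbol list \<Rightarrow> symbol list \<Rightarrow> symbol list" where
  "word_add (x # xs) (y # ys) = symbol_add x y # word_add xs ys"
| "word_add _ _ = []"

fun nonzero :: "symbol \<Rightarrow> bool" where
  "nonzero Z = False" | "nonzero I = True" | "nonzero W = True" | "nonzero V = True"

fun supp :: "symbol list \<Rightarrow> bool list" where
  "supp [] = []" | "supp (x # xs) = nonzero x # supp xs"

fun wt :: "symbol list \<Rightarrow> nat" where
  "wt [] = 0" | "wt (Z # xs) = wt xs" | "wt (I # xs) = Suc (wt xs)"
| "wt (W # xs) = Suc (wt xs)" | "wt (V # xs) = Suc (wt xs)"

fun span_list :: "symbol list list \<Rightarrow> symbol list \<Rightarrow> symbol list list" where
  "span_list [] w = [w]"
| "span_list (g # gs) w = span_list gs w @ span_list gs (word_add g w)"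

fun select :: "bool \<Rightarrow> 'a \<Rightarrow> 'a list" where
  "select True x = [x]" | "select False x = []"

fun words :: "nat \<Rightarrow> symbol list list \<Rightarrow> symbol list \<Rightarrow> symbol list list" where
  "words d [] w = select (wt w = d) w"
| "words d (g # gs) w = words d gs w @ words d gs (word_add g w)"

fun increment :: "nat \<Rightarrow> nat list \<Rightarrow> nat list" where
  "increment k [] = []"
| "increment 0 (c # cs) = Suc c # cs"
| "increment (Suc k) (c # cs) = c # increment k cs"

fun add_lists :: "nat list \<Rightarrow> nat list \<Rightarrow> nat list" where
  "add_lists (x # xs) (y # ys) = (x + y) # add_lists xs ys"
| "add_lists _ _ = []"

text \<open>Twelve bins, for the weights 0 to 11.\<close>

fun hist :: "symbol list list \<Rightarrow> symbol list \<Rightarrow> nat list" where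
  "hist [] w = increment (wt w) (replicate 12 0)"
| "hist (g # gs) w = add_lists (hist gs w) (hist gs (word_add g w))"

fun add_row :: "bool list \<Rightarrow> nat list \<Rightarrow> nat list" where
  "add_row (True # v) (n # ns) = Suc n # add_row v ns"
| "add_row (False # v) (n # ns) = n # add_row v ns"
| "add_row _ _ = []"

fun add_row_if :: "bool \<Rightarrow> bool list \<Rightarrow> nat list \<Rightarrow> nat list" where
  "add_row_if True v r = add_row v r" | "add_row_if False v r = r"

fun add_outer :: "bool list \<Rightarrow> bool list \<Rightarrow> nat list list \<Rightarrow> nat list list" where
  "add_outer (b # bs) v (r # rs) = add_row_if b v r # add_outer bs v rs"
| "add_outer _ _ _ = []"

fun add_outer_if :: "bool \<Rightarrow> bool list \<Rightarrow> nat list list \<Rightarrow> nat list list" where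
  "add_outer_if True v m = add_outer v v m" | "add_outer_if False v m = m"

text \<open>For fixed \<open>i\<close> this is the matrix of the counts \<open>through\<close>,
  accumulated as a sum of outer products of the supports that contain \<open>i\<close>.\<close>

fun slice :: "bool list list \<Rightarrow> nat \<Rightarrow> nat list list" where
  "slice [] i = replicate 11 (replicate 11 0)"
| "slice (v # vs) i = add_outer_if (v ! i) v (slice vs i)"

fun occ :: "symbol \<Rightarrow> symbol list list \<Rightarrow> nat \<Rightarrow> nat" where
  "occ s [] i = 0"
| "occ s (w # ws) i = (if w ! i = s then Suc (occ s ws i) else occ s ws i)"

fun spread_list :: "symbol list list \<Rightarrow> nat \<Rightarrow> int" where
  "spread_list ws i = (int (occ I ws i))\<^sup>2 + (int (occ W ws i))\<^sup>2 + (int (occ V ws i))\<^sup>2"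

fun two_values :: "nat \<Rightarrow> nat \<Rightarrow> nat \<Rightarrow> bool" where
  "two_values 0 0 c = False"
| "two_values 0 (Suc b) 0 = False"
| "two_values (Suc a) 0 0 = False"
| "two_values (Suc a) (Suc b) c = True"
| "two_values (Suc a) 0 (Suc c) = True"
| "two_values 0 (Suc b) (Suc c) = True"

fun varied :: "symbol list list \<Rightarrow> nat \<Rightarrow> bool" where
  "varied ws i = two_values (occ I ws i) (occ W ws i) (occ V ws i)"

fun agree_row :: "nat list \<Rightarrow> nat list \<Rightarrow> nat list \<Rightarrow> nat list \<Rightarrow> bool" where
  "agree_row r r' (q # qs) (j # js) = (if r ! q = r' ! j then agree_row r r' qs js else False)"
| "agree_row _ _ _ _ = True"

text \<open>Each entry is paired only with itself and those behind it. As the tables in question are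
  symmetric, this covers all pairs.\<close>

fun agree_slice :: "nat list list \<Rightarrow> nat list list \<Rightarrow> nat list \<Rightarrow> nat list \<Rightarrow> bool" where
  "agree_slice t t' (q # qs) (j # js) =
     (if agree_row (t ! q) (t' ! j) (q # qs) (j # js) then agree_slice t t' qs js else False)"
| "agree_slice _ _ _ _ = True"

text \<open>The counter \<open>c\<close> is the candidate image, and \<open>ss\<close>,
  \<open>ts\<close> hold the table entries from \<open>c\<close> on. Injectivity is not enforced
  here: surviving candidates are submitted to \<open>is_perm\<close> in
  \<open>certified_perms\<close>.\<close>

fun extensions ::
  "int \<Rightarrow> nat list list \<Rightarrow> nat list \<Rightarrow> nat list \<Rightarrow> nat \<Rightarrow> int list \<Rightarrow> nat list list list \<Rightarrow> nat list list" where
  "extensions s t ps js c (s' # ss) (t' # ts) =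
     (if s' = s then if agree_slice t' t ps js
        then (c # ps) # extensions s t ps js (Suc c) ss ts
        else extensions s t ps js (Suc c) ss ts
      else extensions s t ps js (Suc c) ss ts)"
| "extensions _ _ _ _ _ _ _ = []"

fun extend_all ::
  "int list \<Rightarrow> nat list list list \<Rightarrow> nat \<Rightarrow> nat list \<Rightarrow> nat list list \<Rightarrow> nat list list" where
  "extend_all S T k js [] = []"
| "extend_all S T k js (ps # pss) =
     extensions (S ! k) (T ! k) ps js 0 S T @ extend_all S T k js pss"

text \<open>
\<open>S\<close> and \<open>T\<close> tabulate \<^const>\<open>spread\<close> and \<^const>\<open>through\<close>. A candidate is the
reversed list of the images of \<open>0, \<dots>, m\<close>.
\<close>

fun search :: "int list \<Rightarrow> nat list list list \<Rightarrow> nat \<Rightarrow> nat list list" where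
  "search S T 0 = [[0]]"
| "search S T (Suc k) = extend_all S T (Suc k) (rev [0..<Suc k]) (search S T k)"

text \<open>Behind the diagonal entry, the index is out of range for the rest of the row.\<close>

fun gen :: "nat \<Rightarrow> bool list \<Rightarrow> symbol list" where
  "gen k [] = []"
| "gen 0 (x # xs) = (if x then V else W) # gen (length xs) xs"
| "gen (Suc k) (x # xs) = (if x then I else Z) # gen k xs"

fun gens :: "nat \<Rightarrow> bool list list \<Rightarrow> symbol list list" where
  "gens k [] = []" | "gens k (r # rs) = gen k r # gens (Suc k) rs"

fun permute_rows :: "nat list \<Rightarrow> bool list list \<Rightarrow> bool list list" where
  "permute_rows p [] = []" | "permute_rows p (r # rs) = map ((!) r) p # permute_rows p rs"

fun permuted :: "bool list list \<Rightarrow> nat list \<Rightarrow> bool list list" where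
  "permuted G p = permute_rows p (map ((!) G) p)"

fun nth_column :: "bool list list \<Rightarrow> nat \<Rightarrow> bool list" where
  "nth_column [] j = []" | "nth_column (r # rs) j = r ! j # nth_column rs j"

definition transposed :: "bool list list \<Rightarrow> bool list list" where
  "transposed G = map (nth_column G) [0..<11]"

fun dot :: "bool list \<Rightarrow> bool list \<Rightarrow> bool" where
  "dot (x # xs) (y # ys) = ((x \<and> y) \<noteq> dot xs ys)" | "dot _ _ = False"

text \<open>As in \<open>gen\<close>, the index \<open>length rs\<close> after the diagonal is out
  of range for the rest.\<close>

fun orthogonal_row :: "nat \<Rightarrow> bool list \<Rightarrow> bool list list \<Rightarrow> bool" where
  "orthogonal_row k r [] = True"
| "orthogonal_row 0 r (r' # rs) = (dot r r' \<and> orthogonal_row (length rs) r rs)"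
| "orthogonal_row (Suc k) r (r' # rs) = (\<not> dot r r' \<and> orthogonal_row k r rs)"

fun orthogonal :: "bool list list \<Rightarrow> nat \<Rightarrow> bool list list \<Rightarrow> bool" where
  "orthogonal G k [] = True"
| "orthogonal G k (r # rs) = (orthogonal_row k r G \<and> orthogonal G (Suc k) rs)"

text \<open>The transposing alternative serves the circulant of the squares modulo 11. There
  multiplication of the indices by a square fixes the matrix, and by a nonsquare transposes it since
  -1 is a nonsquare; this gives ten symmetries that fix coordinate 0.\<close>

fun symmetry :: "bool list list \<Rightarrow> bool list list \<Rightarrow> bool \<Rightarrow> nat list \<Rightarrow> bool" where
  "symmetry G G' b p = (if permuted G p = G then True else if b then permuted G p = G' else False)"

text \<open>Only \<open>r\<close> is rotated. The fixed tail \<open>zs\<close> is the border entry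
  in matrix rows, and the fixed coordinates when the same function lists the rotations as
  permutations.\<close>

fun shifts :: "nat \<Rightarrow> 'a list \<Rightarrow> 'a list \<Rightarrow> 'a list list" where
  "shifts 0 r zs = []" | "shifts (Suc k) r zs = (r @ zs) # shifts k (last r # butlast r) zs"

definition indicator_row :: "nat \<Rightarrow> nat list \<Rightarrow> bool list" where
  "indicator_row n js = fold (\<lambda>j r. r[j := True]) js (replicate n False)"

definition circulant :: "nat list \<Rightarrow> bool list list" where
  "circulant js = shifts 11 (indicator_row 11 js) []"

definition bordered :: "nat list \<Rightarrow> bool list list" where
  "bordered js = shifts 10 (indicator_row 10 js) [True] @ [replicate 10 True @ [False]]"

text \<open>A coordinate with another spread than 0 lies outside the orbit of 0. This is what
  excludes the border coordinate, which the rotations fix.\<close>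

fun covered :: "int list \<Rightarrow> nat list list \<Rightarrow> nat \<Rightarrow> bool" where
  "covered S R x = (if S ! x = S ! 0 then list_ex (\<lambda>p. p ! x = 0) R else True)"

fun is_perm :: "nat list \<Rightarrow> bool" where
  "is_perm p = (length p = 11 \<and> distinct p \<and> list_all (\<lambda>x. x < 11) p)"

fun cube_sum :: "nat list \<Rightarrow> int" where
  "cube_sum [] = 0" | "cube_sum (n # ns) = int n ^ 3 + cube_sum ns"

fun cube_sums :: "nat \<Rightarrow> nat list list list \<Rightarrow> int" where
  "cube_sums k [] = 0" | "cube_sums k (t # ts) = cube_sum (t ! k) + cube_sums (Suc k) ts"

definition zero_word :: "symbol list" where
  "zero_word = replicate 11 Z"

text \<open>
The first \<open>m\<close> coordinates are permuted by rotation. The flag \<open>b\<close> admits the symmetries of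
\<open>graph_anti_automorphism\<close>. The values to be certified are the weight distribution \<open>h\<close>, the
signature \<open>s\<close> and the order \<open>a\<close> of the automorphism group.
\<close>

definition certified_perms ::
  "bool list list \<Rightarrow> bool \<Rightarrow> nat list list \<Rightarrow> nat list list \<Rightarrow> nat \<Rightarrow> bool" where
  "certified_perms G b R P a \<longleftrightarrow>
     list_all is_perm R \<and> list_all (symmetry G (transposed G) b) R \<and> distinct (map hd R) \<and>
     list_all is_perm P \<and> list_all (symmetry G (transposed G) b) P \<and> distinct P \<and>
     list_all (\<lambda>p. hd p = 0) P \<and> length R * length P = a"

definition certified_tables ::
  "bool list list \<Rightarrow> bool \<Rightarrow> nat list list \<Rightarrow> int \<Rightarrow> nat \<Rightarrow> int list \<Rightarrow> nat list list list \<Rightarrow> bool" where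
  "certified_tables G b R s a S T \<longleftrightarrow>
     sum_list S + cube_sums 0 T = s \<and> list_all (covered S R) [0..<11] \<and>
     certified_perms G b R (map rev (search S T 10)) a"

definition certified_words ::
  "bool list list \<Rightarrow> bool \<Rightarrow> nat list list \<Rightarrow> int \<Rightarrow> nat \<Rightarrow> symbol list list \<Rightarrow> bool" where
  "certified_words G b R s a ws \<longleftrightarrow>
     distinct (map supp ws) \<and> list_all (varied ws) [0..<11] \<and>
     certified_tables G b R s a (map (spread_list ws) [0..<11]) (map (slice (map supp ws)) [0..<11])"

text \<open>The reversal of the first \<open>m\<close> coordinates negates differences of indices,
  which transposes a circulant block. The rotations in the last line are the elements that move the
  orbit of 0 back to 0.\<close>

definition certified ::
  "bool list list \<Rightarrow> nat \<Rightarrow> bool \<Rightarrow> nat list \<Rightarrow> int \<Rightarrow> nat \<Rightarrow> bool" where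
  "certified G m b h s a \<longleftrightarrow>
     map length G = replicate 11 11 \<and> is_perm (rev [0..<m] @ [m..<11]) \<and>
     permuted G (rev [0..<m] @ [m..<11]) = transposed G \<and>
     (if b then orthogonal G 0 G else True) \<and>
     hist (gens 0 G) zero_word = h \<and>
     certified_words G b (shifts m [0..<m] [m..<11]) s a (words 5 (gens 0 G) zero_word)"

section \<open>Correctness of the evaluation\<close>

definition ix :: "11 \<Rightarrow> nat" where
  "ix = the_inv_into {..<11} of_nat"

lemma bij_betw_of_nat_11: "bij_betw (of_nat :: nat \<Rightarrow> 11) {..<11} UNIV"
proof -
  have "x \<in> of_nat ` {..<11}" for x :: 11
  proof (cases x)
    case (of_int z)
    then show ?thesis by (intro image_eqI[of _ _ "nat z"]) (auto simp: nat_less_iff)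
  qed
  then have surj: "(of_nat :: nat \<Rightarrow> 11) ` {..<11} = UNIV" by blast
  then have "inj_on (of_nat :: nat \<Rightarrow> 11) {..<11}" by (intro eq_card_imp_inj_on) simp_all
  with surj show ?thesis by (simp add: bij_betw_def)
qed

lemma ix_of_nat [simp]: "k < 11 \<Longrightarrow> ix (of_nat k) = k"
  using bij_betw_of_nat_11 by (simp add: ix_def bij_betw_def the_inv_into_f_f)

lemma bij_betw_ix: "bij_betw ix UNIV {..<11}"
  unfolding ix_def by (rule bij_betw_the_inv_into[OF bij_betw_of_nat_11])

lemma ix_less [simp]: "ix i < 11"
  using bij_betw_ix by (auto simp: bij_betw_def)

lemma of_nat_ix [simp]: "of_nat (ix i) = i"
  using bij_betw_of_nat_11 by (simp add: ix_def bij_betw_def f_the_inv_into_f)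

lemma ix_inject [simp]: "ix i = ix j \<longleftrightarrow> i = j"
  by (metis of_nat_ix)

lemma ix_0 [simp]: "ix 0 = 0"
  using ix_of_nat[of 0] by simp

lemma sum_ix: "(\<Sum>i\<in>UNIV. f (ix i)) = (\<Sum>k<11. f k)"
  by (rule sum.reindex_bij_betw[OF bij_betw_ix])

lemma card_ix: "card {i. P (ix i)} = card {k. k < 11 \<and> P k}"
proof (rule bij_betw_same_card[of ix])
  show "bij_betw ix {i. P (ix i)} {k. k < 11 \<and> P k}"
    by (rule bij_betwI[of _ _ _ of_nat]) auto
qed

section \<open>Words as lists of symbols\<close>

fun val :: "symbol \<Rightarrow> gf4" where
  "val Z = GF4 0 0" | "val I = GF4 1 0" | "val W = GF4 0 1" | "val V = GF4 1 1"

lemma val_add: "val (symbol_add x y) = val x + val y"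
  by (cases x; cases y) simp_all

lemma val_inject [simp]: "val x = val y \<longleftrightarrow> x = y"
  by (cases x; cases y) simp_all

lemma val_eq_0_iff [simp]: "val x = 0 \<longleftrightarrow> x = Z"
  by (cases x) (simp_all add: zero_gf4_def)

lemma range_val: "range val = UNIV"
proof (rule card_subset_eq)
  have "(UNIV :: symbol set) = {Z, I, W, V}" by (auto intro: symbol.exhaust)
  then have "card (UNIV :: symbol set) = card {Z, I, W, V}" by (rule arg_cong)
  then show "card (range val) = CARD(gf4)" by (simp add: card_image inj_def card_gf4)
qed simp_all

definition word_vec :: "symbol list \<Rightarrow> gf4 ^ 11" where
  "word_vec xs = (\<chi> i. val (xs ! ix i))"

lemma word_vec_nth [simp]: "word_vec xs $ i = val (xs ! ix i)"
  by (simp add: word_vec_def)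

lemma length_word_add [simp]: "length (word_add xs ys) = min (length xs) (length ys)"
  by (induction xs ys rule: word_add.induct) simp_all

lemma nth_word_add:
  "k < length xs \<Longrightarrow> k < length ys \<Longrightarrow> word_add xs ys ! k = symbol_add (xs ! k) (ys ! k)"
proof (induction xs ys arbitrary: k rule: word_add.induct)
  case (1 x xs y ys)
  then show ?case by (cases k) simp_all
qed simp_all

lemma word_vec_add:
  "length xs = 11 \<Longrightarrow> length ys = 11 \<Longrightarrow> word_vec (word_add xs ys) = word_vec xs + word_vec ys"
  by (simp add: vec_eq_iff nth_word_add val_add)

lemma wt_eq_length_filter: "wt xs = length (filter (\<lambda>x. x \<noteq> Z) xs)"
  by (induction xs rule: wt.induct) simp_all

lemma hamming_weight_word_vec: "length xs = 11 \<Longrightarrow> hamming_weight (word_vec xs) = wt xs"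
  by (simp add: hamming_weight_def wt_eq_length_filter length_filter_conv_card
      card_ix[of "\<lambda>k. xs ! k \<noteq> Z"])

lemma nonzero_iff: "nonzero x \<longleftrightarrow> x \<noteq> Z"
  by (cases x) simp_all

lemma supp_eq_map: "supp xs = map nonzero xs"
  by (induction xs) simp_all

lemma length_span_list: "length (span_list gs w) = 2 ^ length gs"
  by (induction gs arbitrary: w) simp_all

lemma span_list_lengths:
  "length w = 11 \<Longrightarrow> \<forall>g\<in>set gs. length g = 11 \<Longrightarrow> x \<in> set (span_list gs w) \<Longrightarrow> length x = 11"
proof (induction gs arbitrary: w)
  case (Cons g gs)
  then show ?case using Cons.IH[of w] Cons.IH[of "word_add g w"] by auto
qed simp

lemma span_list_word_vec:
  "length w = 11 \<Longrightarrow> \<forall>g\<in>set gs. length g = 11 \<Longrightarrow>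
    word_vec ` set (span_list gs w) =
      range (\<lambda>b. word_vec w + (\<Sum>k<length gs. if b k then word_vec (gs ! k) else 0))"
proof (induction gs arbitrary: w)
  case (Cons g gs)
  let ?s = "\<lambda>b. \<Sum>k<length gs. if b k then word_vec (gs ! k) else 0"
  have "word_vec ` set (span_list (g # gs) w) =
      range (\<lambda>b. word_vec w + ?s b) \<union> range (\<lambda>b. word_vec w + word_vec g + ?s b)"
    using Cons by (simp add: image_Un word_vec_add add.commute[of "word_vec g" "word_vec w"])
  also have "\<dots> = range (\<lambda>b. word_vec w + ((if b 0 then word_vec g else 0) + ?s (\<lambda>k. b (Suc k))))"
    (is "?A = range ?f")
  proof (intro equalityI subsetI)
    fix u assume "u \<in> ?A"
    then consider b where "u = word_vec w + ?s b" | b where "u = word_vec w + word_vec g + ?s b"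
      by auto
    then show "u \<in> range ?f"
    proof cases
      case 1
      \<comment> \<open>\<open>case_nat\<close> puts the choice for the first generator in front of
        the choices for the others.\<close>
      then show ?thesis by (intro image_eqI[of _ _ "case_nat False b"]) simp_all
    next
      case 2
      then show ?thesis by (intro image_eqI[of _ _ "case_nat True b"]) (simp_all add: add.assoc)
    qed
  next
    fix u assume "u \<in> range ?f"
    then obtain b where b: "u = ?f b" by auto
    show "u \<in> ?A"
    proof (cases "b 0")
      case True
      then have "u = word_vec w + word_vec g + ?s (\<lambda>k. b (Suc k))" using b by (simp add: add.assoc)
      then show ?thesis by (intro UnI2) (rule range_eqI)
    next
      case False
      then have "u = word_vec w + ?s (\<lambda>k. b (Suc k))" using b by simp
      then show ?thesis by (intro UnI1) (rule range_eqI)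
    qed
  qed
  finally show ?case by (simp add: sum.lessThan_Suc_shift cong: if_cong
      del: sum.lessThan_Suc span_list.simps)
qed simp

lemma words_eq_filter: "words d gs w = filter (\<lambda>x. wt x = d) (span_list gs w)"
proof (induction gs arbitrary: w)
  case Nil
  then show ?case by (cases "wt w = d") simp_all
qed simp

lemma length_increment [simp]: "length (increment k cs) = length cs"
  by (induction k cs rule: increment.induct) simp_all

lemma nth_increment: "i < length cs \<Longrightarrow> increment k cs ! i = cs ! i + of_bool (k = i)"
  by (induction k cs arbitrary: i rule: increment.induct) (auto simp: nth_Cons split: nat.split)

lemma length_add_lists [simp]: "length (add_lists xs ys) = min (length xs) (length ys)"
  by (induction xs ys rule: add_lists.induct) simp_all

lemma nth_add_lists:
  "i < length xs \<Longrightarrow> i < length ys \<Longrightarrow> add_lists xs ys ! i = xs ! i + ys ! i"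
  by (induction xs ys arbitrary: i rule: add_lists.induct) (auto simp: nth_Cons split: nat.split)

lemma length_hist [simp]: "length (hist gs w) = 12"
  by (induction gs arbitrary: w) simp_all

lemma nth_hist: "i < 12 \<Longrightarrow> hist gs w ! i = length (filter (\<lambda>x. wt x = i) (span_list gs w))"
  by (induction gs arbitrary: w) (simp_all add: nth_increment nth_add_lists)

lemma occ_eq: "occ s ws i = length (filter (\<lambda>w. w ! i = s) ws)"
  by (induction ws) simp_all

lemma length_add_row [simp]: "length (add_row v ns) = min (length v) (length ns)"
  by (induction v ns rule: add_row.induct) simp_all

lemma nth_add_row:
  "k < length v \<Longrightarrow> k < length ns \<Longrightarrow> add_row v ns ! k = ns ! k + of_bool (v ! k)"
  by (induction v ns arbitrary: k rule: add_row.induct) (auto simp: nth_Cons split: nat.split)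

lemma length_add_outer [simp]: "length (add_outer bs v m) = min (length bs) (length m)"
  by (induction bs v m rule: add_outer.induct) simp_all

lemma nth_add_outer:
  "j < length bs \<Longrightarrow> j < length m \<Longrightarrow> add_outer bs v m ! j = add_row_if (bs ! j) v (m ! j)"
  by (induction bs v m arbitrary: j rule: add_outer.induct) (auto simp: nth_Cons split: nat.split)

lemma slice_dims:
  assumes "\<forall>v\<in>set vs. length v = 11"
  shows "length (slice vs i) = 11 \<and> (\<forall>j<11. length (slice vs i ! j) = 11)"
  using assms
proof (induction vs)
  case (Cons v vs)
  then show ?case
    by (cases "v ! i"; simp add: nth_add_outer)
      (metis (full_types) add_row_if.simps length_add_row min.idem)
qed simp

lemma nth_slice:
  assumes "\<forall>v\<in>set vs. length v = 11" "j < 11" "k < 11"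
  shows "slice vs i ! j ! k = length (filter (\<lambda>v. v ! i \<and> v ! j \<and> v ! k) vs)"
  using assms
proof (induction vs)
  case (Cons v vs)
  have "length (slice vs i) = 11" "length (slice vs i ! j) = 11"
    using slice_dims[of vs i] Cons.prems by simp_all
  with Cons show ?case
    by (cases "v ! i"; cases "v ! j") (simp_all add: nth_add_outer nth_add_row)
qed simp

lemma length_gen [simp]: "length (gen k xs) = length xs"
  by (induction k xs rule: gen.induct) simp_all

lemma nth_gen:
  "i < length xs \<Longrightarrow> gen k xs ! i = (if i = k then if xs ! i then V else W else if xs ! i then I else Z)"
proof (induction k xs arbitrary: i rule: gen.induct)
  case (2 x xs)
  then show ?case by (cases i) auto
next
  case (3 k x xs)
  then show ?case by (cases i) auto
qed simp

lemma length_gens [simp]: "length (gens k G) = length G"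
  by (induction k G rule: gens.induct) simp_all

lemma nth_gens: "j < length G \<Longrightarrow> gens k G ! j = gen (k + j) (G ! j)"
  by (induction k G arbitrary: j rule: gens.induct) (auto simp: nth_Cons split: nat.split)

lemma permuted_eq: "permuted G p = map (\<lambda>a. map (\<lambda>b. G ! a ! b) p) p"
proof -
  have "permute_rows p rs = map (\<lambda>r. map ((!) r) p) rs" for rs
    by (induction rs) simp_all
  then show ?thesis by simp
qed

lemma transposed_eq: "transposed G = map (\<lambda>j. map (\<lambda>r. r ! j) G) [0..<11]"
proof -
  have "nth_column G j = map (\<lambda>r. r ! j) G" for j
    by (induction G) simp_all
  then show ?thesis by (simp add: transposed_def)
qed

lemma of_bool_dot:
  "length xs = length ys \<Longrightarrow>
    (of_bool (dot xs ys) :: bit) = (\<Sum>k<length xs. of_bool (xs ! k) * of_bool (ys ! k))"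
proof (induction xs ys rule: dot.induct)
  case (1 x xs y ys)
  have "of_bool (dot (x # xs) (y # ys)) = (of_bool x * of_bool y + of_bool (dot xs ys) :: bit)"
    by (cases x; cases y; cases "dot xs ys") simp_all
  with 1 show ?case by (simp add: sum.lessThan_Suc_shift del: sum.lessThan_Suc dot.simps)
qed simp_all

lemma orthogonal_row_iff:
  "orthogonal_row k r rs \<longleftrightarrow> (\<forall>i<length rs. dot r (rs ! i) = (i = k))"
proof (induction k r rs rule: orthogonal_row.induct)
  case (2 r r' rs)
  then show ?case by (auto simp: nth_Cons split: nat.split)
next
  case (3 k r r' rs)
  then show ?case by (auto simp: nth_Cons split: nat.split)
qed simp

lemma orthogonal_iff:
  "orthogonal G k rs \<longleftrightarrow> (\<forall>i<length rs. \<forall>j<length G. dot (rs ! i) (G ! j) = (j = k + i))"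
  by (induction G k rs rule: orthogonal.induct)
    (auto simp: orthogonal_row_iff nth_Cons split: nat.split)

section \<open>Completeness of the search for permutations\<close>

lemma agree_rowI:
  "(\<And>q j. (q, j) \<in> set (zip qs js) \<Longrightarrow> r ! q = r' ! j) \<Longrightarrow> agree_row r r' qs js"
  by (induction r r' qs js rule: agree_row.induct) simp_all

lemma agree_sliceI:
  "(\<And>q j q' j'. (q, j) \<in> set (zip qs js) \<Longrightarrow> (q', j') \<in> set (zip qs js) \<Longrightarrow> t ! q ! q' = t' ! j ! j') \<Longrightarrow>
    agree_slice t t' qs js"
proof (induction t t' qs js rule: agree_slice.induct)
  case (1 t t' q qs j js)
  have "agree_row (t ! q) (t' ! j) (q # qs) (j # js)"
    by (rule agree_rowI) (use 1(2) in auto)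
  moreover from this have "agree_slice t t' qs js"
    by (rule 1(1)) (use 1(2) in auto)
  ultimately show ?case by simp
qed simp_all

lemma extensions_complete:
  "n < length ss \<Longrightarrow> n < length ts \<Longrightarrow> ss ! n = s \<Longrightarrow> agree_slice (ts ! n) t ps js \<Longrightarrow>
    (c + n) # ps \<in> set (extensions s t ps js c ss ts)"
proof (induction n arbitrary: c ss ts)
  case 0
  then show ?case by (cases ss; cases ts) auto
next
  case (Suc n)
  then obtain s' ss' t' ts' where "ss = s' # ss'" "ts = t' # ts'"
    by (metis length_Suc_conv Suc_less_eq less_natE list.size(3) not_less_zero neq_Nil_conv)
  with Suc.IH[of ss' ts' "Suc c"] Suc.prems show ?case by simp
qed

lemma extend_all_eq:
  "set (extend_all S T k js pss) = (\<Union>ps\<in>set pss. set (extensions (S ! k) (T ! k) ps js 0 S T))"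
  by (induction S T k js pss rule: extend_all.induct) auto

text \<open>A map that fixes 0 and preserves both tables passes every test, so its initial segments
  stay among the candidates. Only this direction is needed, since each final candidate is verified
  separately.\<close>

lemma search_complete:
  assumes "length S = 11" "length T = 11" "\<pi> 0 = 0"
    and \<pi>: "\<And>i. i < 11 \<Longrightarrow> \<pi> i < (11::nat)"
    and S: "\<And>i. i < 11 \<Longrightarrow> S ! \<pi> i = S ! i"
    and T: "\<And>i j k. i < 11 \<Longrightarrow> j < 11 \<Longrightarrow> k < 11 \<Longrightarrow> T ! \<pi> i ! \<pi> j ! \<pi> k = T ! i ! j ! k"
  shows "m < 11 \<Longrightarrow> rev (map \<pi> [0..<Suc m]) \<in> set (search S T m)"
proof (induction m)
  case 0
  then show ?case using assms(3) by simp
next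
  case (Suc m)
  let ?ps = "rev (map \<pi> [0..<Suc m])"
  have "zip ?ps (rev [0..<Suc m]) = rev (map (\<lambda>i. (\<pi> i, i)) [0..<Suc m])"
    by (simp add: zip_rev zip_map1 zip_same_conv_map del: upt_Suc)
  then have zip: "set (zip ?ps (rev [0..<Suc m])) = (\<lambda>i. (\<pi> i, i)) ` {0..<Suc m}"
    by (simp del: upt_Suc)
  have "agree_slice (T ! \<pi> (Suc m)) (T ! Suc m) ?ps (rev [0..<Suc m])"
    by (rule agree_sliceI) (use T Suc.prems in \<open>auto simp: zip simp del: upt_Suc\<close>)
  then have "(0 + \<pi> (Suc m)) # ?ps \<in>
      set (extensions (S ! Suc m) (T ! Suc m) ?ps (rev [0..<Suc m]) 0 S T)"
    using assms \<pi>[of "Suc m"] S[of "Suc m"] Suc.prems by (intro extensions_complete) simp_all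
  moreover have "rev (map \<pi> [0..<Suc (Suc m)]) = \<pi> (Suc m) # ?ps" by simp
  ultimately show ?case using Suc by (auto simp: extend_all_eq simp del: upt_Suc)
qed

section \<open>Certified codes\<close>

definition adj :: "bool list list \<Rightarrow> 11 \<Rightarrow> 11 \<Rightarrow> bool" where
  "adj G i j = G ! ix i ! ix j"

abbreviation code :: "bool list list \<Rightarrow> (gf4 ^ 11) set" where
  "code G \<equiv> graph_code (adj G)"

definition perm_of :: "nat list \<Rightarrow> 11 \<Rightarrow> 11" where
  "perm_of p i = of_nat (p ! ix i)"

lemma ix_perm_of: "is_perm p \<Longrightarrow> ix (perm_of p i) = p ! ix i"
  by (simp add: perm_of_def list_all_length)

lemma bij_perm_of:
  assumes "is_perm p"
  shows "bij (perm_of p)"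
proof -
  have "inj (perm_of p)"
  proof (rule injI)
    fix i j assume "perm_of p i = perm_of p j"
    then have "p ! ix i = p ! ix j" using ix_perm_of[OF assms] by metis
    then show "i = j" using assms by (simp add: nth_eq_iff_index_eq)
  qed
  then show ?thesis by (simp add: bij_def finite_UNIV_inj_surj)
qed

lemma inj_on_perm_of: "inj_on perm_of {p. is_perm p}"
proof (rule inj_onI)
  fix p q assume *: "p \<in> {p. is_perm p}" "q \<in> {p. is_perm p}" and eq: "perm_of p = perm_of q"
  have "p ! k = q ! k" if "k < 11" for k
    using ix_perm_of[of p "of_nat k"] ix_perm_of[of q "of_nat k"] * eq that by simp
  then show "p = q" using * by (intro nth_equalityI) simp_all
qed

context
  fixes G :: "bool list list"
  assumes G: "map length G = replicate 11 11"
begin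

lemma length_G: "length G = 11"
  using arg_cong[OF G, of length] by simp

lemma length_row: "k < 11 \<Longrightarrow> length (G ! k) = 11"
  using arg_cong[OF G, of "\<lambda>xs. xs ! k"] length_G by simp

lemma adj_permuted: "is_perm p \<Longrightarrow> adj G (perm_of p i) (perm_of p j) = permuted G p ! ix i ! ix j"
  by (simp add: adj_def ix_perm_of permuted_eq del: permuted.simps)

lemma adj_transposed: "adj G j i = transposed G ! ix i ! ix j"
  by (simp add: adj_def transposed_eq length_G)

lemma gens_row: "k < 11 \<Longrightarrow> word_vec (gens 0 G ! k) = graph_row (adj G) (of_nat k)"
  by (auto simp: vec_eq_iff nth_gens length_G nth_gen length_row graph_row_def adj_def)

abbreviation all_words :: "symbol list list" where
  "all_words \<equiv> span_list (gens 0 G) zero_word"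

abbreviation light_words :: "symbol list list" where
  "light_words \<equiv> words 5 (gens 0 G) zero_word"

lemma gens_lengths: "\<forall>g\<in>set (gens 0 G). length g = 11"
  by (auto simp: in_set_conv_nth length_G nth_gens length_row)

lemma length_zero_word: "length zero_word = 11"
  by (simp add: zero_word_def)

lemma all_words_lengths: "x \<in> set all_words \<Longrightarrow> length x = 11"
  by (rule span_list_lengths[OF length_zero_word gens_lengths])

lemma set_all_words: "word_vec ` set all_words = code G"
proof -
  have zero: "word_vec zero_word = 0" by (simp add: zero_word_def vec_eq_iff zero_gf4_def)
  have "word_vec ` set all_words =
      range (\<lambda>b. \<Sum>k<11. if b k then word_vec (gens 0 G ! k) else 0)"
    using span_list_word_vec[OF length_zero_word gens_lengths] by (simp add: zero length_G)
  also have "\<dots> = range (\<lambda>b. \<Sum>k<11. if b k then graph_row (adj G) (of_nat k) else 0)"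
    by (simp add: gens_row cong: if_cong)
  also have "\<dots> = range (\<lambda>b. \<Sum>j\<in>UNIV. if b j then graph_row (adj G) j else 0)" (is "range ?f = range ?g")
  proof -
    have f: "?f b = ?g (\<lambda>j. b (ix j))" for b
      using sum_ix[of "\<lambda>k. if b k then graph_row (adj G) (of_nat k) else 0", symmetric]
      by (simp only: of_nat_ix)
    have g: "?g b = ?f (\<lambda>k. b (of_nat k))" for b
      by (simp add: f)
    show ?thesis
    proof (intro equalityI subsetI)
      show "u \<in> range ?g" if "u \<in> range ?f" for u using that f by auto
      show "u \<in> range ?f" if "u \<in> range ?g" for u
        using that by (auto simp only: g intro!: rangeI elim!: rangeE)
    qed
  qed
  finally show ?thesis by (simp add: graph_code_rows)
qed

text \<open>The list has 2^11 entries and covers a code of 2^11 words, so nothing is repeated. Hence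
  filtering the list counts codewords.\<close>

lemma distinct_all_words: "distinct (map word_vec all_words)"
proof (rule card_distinct)
  show "card (set (map word_vec all_words)) = length (map word_vec all_words)"
    using card_graph_code[of "adj G"] by (simp add: set_all_words length_span_list length_G)
qed

lemma card_code_filter: "card {c \<in> code G. P c} = length (filter (\<lambda>x. P (word_vec x)) all_words)"
proof -
  have "{c \<in> code G. P c} = set (filter P (map word_vec all_words))"
    by (auto simp: set_all_words)
  then show ?thesis
    using distinct_card[OF distinct_filter[OF distinct_all_words, of P]] by (simp add: filter_map o_def)
qed

lemma weight_count_hist:
  assumes "w < 12"
  shows "weight_count (code G) w = hist (gens 0 G) zero_word ! w"
proof -
  have "filter (\<lambda>x. hamming_weight (word_vec x) = w) all_words = filter (\<lambda>x. wt x = w) all_words"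
    by (rule filter_cong) (simp_all add: all_words_lengths hamming_weight_word_vec)
  with assms show ?thesis
    by (simp add: weight_count_def card_code_filter nth_hist)
qed

lemma light_words_lengths: "x \<in> set light_words \<Longrightarrow> length x = 11"
  by (auto simp: words_eq_filter all_words_lengths)

lemma set_light_words: "words_of_weight 5 (code G) = word_vec ` set light_words"
  by (auto simp: words_of_weight_def words_eq_filter set_all_words[symmetric]
      all_words_lengths hamming_weight_word_vec)

lemma card_light_words:
  "card {c \<in> words_of_weight 5 (code G). P c} = length (filter (\<lambda>x. P (word_vec x)) light_words)"
proof -
  have "card {c \<in> words_of_weight 5 (code G). P c} =
      length (filter (\<lambda>x. hamming_weight (word_vec x) = 5 \<and> P (word_vec x)) all_words)"
    using card_code_filter[of "\<lambda>c. hamming_weight c = 5 \<and> P c"]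
    by (simp add: words_of_weight_def conj_assoc)
  also have "filter (\<lambda>x. hamming_weight (word_vec x) = 5 \<and> P (word_vec x)) all_words =
      filter (\<lambda>x. wt x = 5 \<and> P (word_vec x)) all_words"
    by (rule filter_cong) (simp_all add: all_words_lengths hamming_weight_word_vec)
  finally show ?thesis by (simp add: words_eq_filter conj_commute)
qed

lemma through_slice:
  "through 5 (code G) i j k = slice (map supp light_words) (ix i) ! ix j ! ix k"
proof -
  have "\<forall>v\<in>set (map supp light_words). length v = 11"
    by (simp add: supp_eq_map light_words_lengths)
  then have "slice (map supp light_words) (ix i) ! ix j ! ix k =
      length (filter (\<lambda>x. supp x ! ix i \<and> supp x ! ix j \<and> supp x ! ix k) light_words)"
    by (simp add: nth_slice filter_map o_def)
  also have "filter (\<lambda>x. supp x ! ix i \<and> supp x ! ix j \<and> supp x ! ix k) light_words =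
      filter (\<lambda>x. x ! ix i \<noteq> Z \<and> x ! ix j \<noteq> Z \<and> x ! ix k \<noteq> Z) light_words"
    by (rule filter_cong) (simp_all add: supp_eq_map nonzero_iff light_words_lengths)
  finally show ?thesis by (simp add: through_def card_light_words)
qed

lemma spread_spread_list: "spread 5 (code G) i = spread_list light_words (ix i)"
proof -
  have "UNIV - {0} = range val - {val Z}" by (simp add: range_val zero_gf4_def)
  also have "\<dots> = val ` (UNIV - {Z})" by (simp add: image_set_diff inj_def)
  also have "UNIV - {Z} = {I, W, V}" by (auto intro: symbol.exhaust)
  finally have "UNIV - {0} = val ` {I, W, V}" .
  then have "spread 5 (code G) i =
      (\<Sum>s\<in>{I, W, V}. (int (card {c \<in> words_of_weight 5 (code G). c $ i = val s}))\<^sup>2)"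
    by (simp add: spread_def sum.reindex inj_on_def)
  then show ?thesis by (simp add: card_light_words occ_eq)
qed

lemma signature_tables:
  "signature 5 (code G) = sum_list (map (spread_list light_words) [0..<11]) +
    cube_sums 0 (map (slice (map supp light_words)) [0..<11])"
proof -
  let ?T = "slice (map supp light_words)"
  have dims: "length (?T i ! j) = 11" if "j < 11" for i j
    using slice_dims[of "map supp light_words" i] that by (simp add: supp_eq_map light_words_lengths)
  have cube_sum: "cube_sum ns = (\<Sum>k<length ns. int (ns ! k) ^ 3)" for ns
    by (induction ns) (simp_all add: sum.lessThan_Suc_shift del: sum.lessThan_Suc)
  \<comment> \<open>Row \<open>i\<close> of slice \<open>i\<close> holds the counts
    \<open>through\<close> at \<open>i\<close>, \<open>i\<close>, \<open>j\<close> that enter the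
    signature.\<close>
  have cube_sums: "cube_sums k ts = (\<Sum>i<length ts. cube_sum (ts ! i ! (k + i)))" for k ts
    by (induction k ts rule: cube_sums.induct)
      (simp_all add: sum.lessThan_Suc_shift del: sum.lessThan_Suc)
  have "(\<Sum>i\<in>UNIV. \<Sum>j\<in>UNIV. int (through 5 (code G) i i j) ^ 3) =
      (\<Sum>i<11. \<Sum>j<11. int (?T i ! i ! j) ^ 3)"
    using sum_ix[of "\<lambda>i. \<Sum>j<11. int (?T i ! i ! j) ^ 3"]
      sum_ix[of "\<lambda>j. int (?T (ix i) ! ix i ! j) ^ 3" for i]
    by (simp add: through_slice)
  moreover have "(\<Sum>i\<in>UNIV. spread 5 (code G) i) = (\<Sum>i<11. spread_list light_words i)"
    using sum_ix[of "spread_list light_words"] by (simp add: spread_spread_list del: spread_list.simps)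
  ultimately show ?thesis
    by (simp add: signature_def cube_sums cube_sum dims interv_sum_list_conv_sum_set_nat
        atLeast0LessThan del: spread_list.simps upt_rec_numeral)
qed

section \<open>The automorphism group from the words of weight 5\<close>

lemma supports_light_words:
  assumes "distinct (map supp light_words)"
  shows "inj_on (\<lambda>c. {i. c $ i \<noteq> 0}) (words_of_weight 5 (code G))"
proof (rule inj_onI)
  fix c d assume "c \<in> words_of_weight 5 (code G)" "d \<in> words_of_weight 5 (code G)"
    and eq: "{i. c $ i \<noteq> 0} = {i. d $ i \<noteq> 0}"
  then obtain x y where xy: "x \<in> set light_words" "y \<in> set light_words" "c = word_vec x" "d = word_vec y"
    by (auto simp: set_light_words)
  have "supp x ! k = supp y ! k" if "k < 11" for k
    using eq that light_words_lengths[OF xy(1)] light_words_lengths[OF xy(2)]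
    by (auto simp: xy supp_eq_map nonzero_iff set_eq_iff dest: spec[of _ "of_nat k"])
  then have "supp x = supp y"
    using light_words_lengths[OF xy(1)] light_words_lengths[OF xy(2)]
    by (intro nth_equalityI) (simp_all add: supp_eq_map)
  then have "x = y" using assms xy(1,2) by (auto simp: distinct_map dest: inj_onD)
  then show "c = d" by (simp add: xy)
qed

lemma varied_light_words:
  assumes "list_all (varied light_words) [0..<11]"
  shows "\<exists>c\<in>words_of_weight 5 (code G). \<exists>d\<in>words_of_weight 5 (code G).
    c $ i \<noteq> 0 \<and> d $ i \<noteq> 0 \<and> c $ i \<noteq> d $ i"
proof -
  have two: "two_values a b c \<Longrightarrow> 0 < a \<and> 0 < b \<or> 0 < a \<and> 0 < c \<or> 0 < b \<and> 0 < c" for a b c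
    by (induction a b c rule: two_values.induct) simp_all
  have pos: "0 < occ s light_words (ix i) \<Longrightarrow> \<exists>x\<in>set light_words. x ! ix i = s" for s
    by (auto simp: occ_eq filter_empty_conv)
  have "varied light_words (ix i)" using assms by (simp add: list_all_length)
  then have "\<exists>s t. s \<noteq> t \<and> s \<noteq> Z \<and> t \<noteq> Z \<and>
      0 < occ s light_words (ix i) \<and> 0 < occ t light_words (ix i)"
    using two[of "occ I light_words (ix i)" "occ W light_words (ix i)" "occ V light_words (ix i)"]
    by (metis symbol.distinct varied.simps)
  then obtain s t where st: "s \<noteq> t" "s \<noteq> Z" "t \<noteq> Z"
    "0 < occ s light_words (ix i)" "0 < occ t light_words (ix i)"
    by blast
  then obtain x y where "x \<in> set light_words" "y \<in> set light_words" "x ! ix i = s" "y ! ix i = t"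
    using pos by meson
  with st show ?thesis by (auto simp: set_light_words)
qed

lemma symmetry_aut_perm:
  assumes p: "is_perm p" "symmetry G (transposed G) b p" and b: "if b then orthogonal G 0 G else True"
  shows "perm_of p \<in> aut_perms (code G)"
proof -
  have "permuted G p = G \<or> b \<and> permuted G p = transposed G"
    using p(2) by (simp del: permuted.simps split: if_splits)
  then show ?thesis
  proof
    assume "permuted G p = G"
    then have "adj G (perm_of p i) (perm_of p j) = adj G i j" for i j
      by (simp add: adj_permuted[OF p(1)] del: permuted.simps) (simp add: adj_def)
    then show ?thesis by (rule graph_automorphism[OF bij_perm_of[OF p(1)]])
  next
    assume *: "b \<and> permuted G p = transposed G"
    then have A: "adj G (perm_of p i) (perm_of p j) = adj G j i" for i j
      by (simp add: adj_permuted[OF p(1)] adj_transposed[symmetric] del: permuted.simps)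
    have "(\<Sum>j\<in>UNIV. of_bool (adj G i j) * of_bool (adj G k j)) = (of_bool (i = k) :: bit)" for i k
    proof -
      have "(\<Sum>j\<in>UNIV. of_bool (adj G i j) * of_bool (adj G k j)) =
          (\<Sum>l<11. of_bool (G ! ix i ! l) * of_bool (G ! ix k ! l) :: bit)"
        unfolding adj_def by (rule sum_ix[of "\<lambda>l. of_bool (G ! ix i ! l) * of_bool (G ! ix k ! l)"])
      also have "\<dots> = of_bool (dot (G ! ix i) (G ! ix k))"
        by (simp add: of_bool_dot length_row)
      also have "dot (G ! ix i) (G ! ix k) = (i = k)"
        using b * by (auto simp: orthogonal_iff length_G)
      finally show ?thesis .
    qed
    with A show ?thesis
      by (intro graph_anti_automorphism[where A = "adj G"] bij_perm_of[OF p(1)])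
  qed
qed

text \<open>By \<open>search_complete\<close> every automorphism permutation fixing 0 is among the
  candidates, and by \<open>symmetry_aut_perm\<close> every candidate comes from an automorphism. So
  the stabilizer of 0 is known exactly, and \<open>R\<close> accounts for the orbit of 0.\<close>

lemma card_aut_perms:
  assumes b: "if b then orthogonal G 0 G else True"
    and cert: "certified_tables G b R s a (map (spread_list light_words) [0..<11])
      (map (slice (map supp light_words)) [0..<11])" (is "certified_tables G b R s a ?S ?T")
  shows "card (aut_perms (code G)) = a"
proof -
  let ?P = "map rev (search ?S ?T 10)"
  have cover: "covered ?S R x" if "x < 11" for x
    using cert that by (simp add: certified_tables_def list_all_length del: covered.simps upt_rec_numeral)
  have R: "is_perm r" "symmetry G (transposed G) b r" if "r \<in> set R" for r
    using cert that
    by (simp_all add: certified_tables_def certified_perms_def list_all_iff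
        del: is_perm.simps symmetry.simps)
  have P: "is_perm q" "symmetry G (transposed G) b q" "hd q = 0" if "q \<in> set ?P" for q
    using cert that
    by (simp_all add: certified_tables_def certified_perms_def list_all_iff
        del: is_perm.simps symmetry.simps set_map upt_rec_numeral)
  have distinct: "distinct (map hd R)" "distinct ?P" "length R * length ?P = a"
    using cert by (simp_all add: certified_tables_def certified_perms_def del: length_map upt_rec_numeral)
  have perm_of_0: "perm_of r 0 = of_nat (hd r)" if "is_perm r" for r
  proof -
    have "r \<noteq> []" using that by auto
    then show ?thesis by (simp add: perm_of_def hd_conv_nth)
  qed
  have "card (aut_perms (code G)) = card (perm_of ` set R) * card (perm_of ` set ?P)"
  proof (rule card_orbit_stabilizer[where b = 0])
    show "bij p" if "p \<in> aut_perms (code G)" for p using that by (simp add: aut_perms_def)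
    show "q \<circ> p \<in> aut_perms (code G)" if "p \<in> aut_perms (code G)" "q \<in> aut_perms (code G)" for p q
      using that by (rule aut_perms_comp)
    show "perm_of ` set R \<subseteq> aut_perms (code G)" using symmetry_aut_perm[OF R b] by blast
    show "perm_of ` set ?P \<subseteq> aut_perms (code G)" using symmetry_aut_perm[OF P(1,2) b] by blast
    show "inj_on (\<lambda>r. r 0) (perm_of ` set R)"
    proof (rule inj_onI, clarify)
      fix r r' assume r: "r \<in> set R" "r' \<in> set R" "perm_of r 0 = perm_of r' 0"
      have "ix (perm_of q 0) = hd q" if "is_perm q" for q
      proof -
        have "hd q < 11" using that by (cases q) auto
        then show ?thesis using perm_of_0[OF that] by simp
      qed
      then have "hd r = hd r'" using r R(1) by metis
      then have "r = r'" using distinct(1) r(1,2) by (auto simp: distinct_map dest: inj_onD)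
      then show "perm_of r = perm_of r'" by simp
    qed
    show "p 0 = 0" if "p \<in> perm_of ` set ?P" for p
      using that perm_of_0[OF P(1)] P(3) by (auto simp del: set_map)
    show "p \<in> perm_of ` set ?P" if p: "p \<in> aut_perms (code G)" "p 0 = 0" for p
    proof -
      let ?\<pi> = "\<lambda>k. ix (p (of_nat k))"
      have "rev (map ?\<pi> [0..<Suc 10]) \<in> set (search ?S ?T 10)"
      proof (rule search_complete)
        show "?S ! ?\<pi> i = ?S ! i" if "i < 11" for i
          using that aut_perms_spread[OF p(1), of 5 "of_nat i"]
          by (simp add: spread_spread_list del: spread_list.simps upt_rec_numeral)
        show "?T ! ?\<pi> i ! ?\<pi> j ! ?\<pi> k = ?T ! i ! j ! k" if "i < 11" "j < 11" "k < 11" for i j k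
          using that aut_perms_through[OF p(1), of 5 "of_nat i" "of_nat j" "of_nat k"]
          by (simp add: through_slice del: upt_rec_numeral)
      qed (simp_all add: p(2) del: upt_rec_numeral)
      \<comment> \<open>The search builds its lists backwards, which the \<open>rev\<close> in
        \<open>?P\<close> undoes.\<close>
      then have "map ?\<pi> [0..<11] \<in> set ?P"
        by (auto simp: image_iff simp del: upt_rec_numeral intro!: bexI)
      moreover have "p = perm_of (map ?\<pi> [0..<11])"
        by (simp add: fun_eq_iff perm_of_def del: upt_rec_numeral)
      ultimately show ?thesis by (rule image_eqI[rotated])
    qed
    show "\<exists>r\<in>perm_of ` set R. r (p 0) = 0" if p: "p \<in> aut_perms (code G)" for p
    proof -
      have "?S ! ix (p 0) = ?S ! 0"
        using aut_perms_spread[OF p, of 5 0]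
        by (simp add: spread_spread_list del: spread_list.simps upt_rec_numeral)
      then obtain r where r: "r \<in> set R" "r ! ix (p 0) = 0"
        using cover[of "ix (p 0)"] by (auto simp: list_ex_iff simp del: upt_rec_numeral)
      then show ?thesis by (auto simp: perm_of_def intro!: bexI[of _ r])
    qed
  qed
  moreover have "card (perm_of ` set R) = length R"
  proof -
    have "distinct R" using distinct(1) by (simp add: distinct_map)
    moreover have "inj_on perm_of (set R)"
      using R(1) by (auto intro!: inj_on_subset[OF inj_on_perm_of] simp del: is_perm.simps)
    ultimately show ?thesis by (simp add: card_image distinct_card)
  qed
  moreover have "card (perm_of ` set ?P) = length ?P"
  proof -
    have "inj_on perm_of (set ?P)"
      using P(1) by (auto intro!: inj_on_subset[OF inj_on_perm_of] simp del: is_perm.simps set_map)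
    then show ?thesis using distinct(2) by (simp only: card_image distinct_card)
  qed
  ultimately show ?thesis using distinct(3) by simp
qed

end

lemma poly_weight_enumerator:
  "poly (weight_enumerator (C :: (gf4 ^ 'n::finite) set)) 1 =
    (\<Sum>i\<le>CARD('n). monom (int (weight_count C i)) i)"
  by (simp add: weight_enumerator_def poly_sum poly_monom)

lemma Poly_eq_sum_monom: "Poly xs = (\<Sum>i<length xs. monom (xs ! i) i)"
  by (rule poly_eqI) (simp add: coeff_sum nth_default_def sum.delta)

lemma certified_code:
  assumes cert: "certified G m b h s a"
    and h: "h ! 1 = 0" "h ! 2 = 0" "h ! 3 = 0" "h ! 4 = 0" "0 < h ! 5"
  shows "additive_code 11 5 (code G)"
    and "formally_self_dual (code G)"
    and "poly (weight_enumerator (code G)) 1 = Poly (map int h)"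
    and "signature 5 (code G) = s"
    and "card (automorphism_group (code G)) = a"
proof -
  let ?p = "rev [0..<m] @ [m..<11]"
  let ?ws = "words 5 (gens 0 G) zero_word"
  have G: "map length G = replicate 11 11" and p: "is_perm ?p"
    and p': "permuted G ?p = transposed G" and b: "if b then orthogonal G 0 G else True"
    and hist: "h = hist (gens 0 G) zero_word"
    and words: "distinct (map supp ?ws)" "list_all (varied ?ws) [0..<11]"
    and tables: "certified_tables G b (shifts m [0..<m] [m..<11]) s a
      (map (spread_list ?ws) [0..<11]) (map (slice (map supp ?ws)) [0..<11])"
    using cert unfolding certified_def certified_words_def by blast+
  have count: "weight_count (code G) w = h ! w" if "w < 12" for w
    using that by (simp add: hist weight_count_hist[OF G])
  show "card (automorphism_group (code G)) = a"
    using card_automorphism_group[OF supports_light_words[OF G words(1)] varied_light_words[OF G words(2)]]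
      card_aut_perms[OF G b tables] by simp
  show "signature 5 (code G) = s"
    using tables unfolding signature_tables[OF G] certified_tables_def by blast
  show "poly (weight_enumerator (code G)) 1 = Poly (map int h)"
    unfolding poly_weight_enumerator Poly_eq_sum_monom
    by (rule sum.cong) (auto simp: hist weight_count_hist[OF G])
  \<comment> \<open>The certified reversal carries the matrix to its transpose, which yields formal
    self-duality.\<close>
  have "adj G (perm_of ?p i) (perm_of ?p j) = adj G j i" for i j
    by (rule trans[OF adj_permuted[OF G p]]) (simp only: p' adj_transposed[OF G, of j i])
  then have "weight_count (dual_code (code G)) w = weight_count (code G) w" for w
    by (rule weight_count_dual_graph_code[OF bij_perm_of[OF p]])
  then show "formally_self_dual (code G)"
    by (simp add: formally_self_dual_def weight_enumerator_def)
  have "minimum_weight (code G) = 5"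
    unfolding minimum_weight_def
  proof (rule Min_eqI)
    fix w assume "w \<in> hamming_weight ` (code G - {0})"
    then obtain c where c: "c \<in> code G" "c \<noteq> 0" "w = hamming_weight c" by blast
    have "w \<noteq> 0" using c(2,3) by (auto simp: hamming_weight_def vec_eq_iff)
    \<comment> \<open>The word \<open>c\<close> itself is counted at its weight, so the zero entries
      of \<open>h\<close> exclude the weights 1 to 4.\<close>
    have "0 < weight_count (code G) w"
      unfolding weight_count_def using c by (subst card_gt_0_iff) auto
    with \<open>w \<noteq> 0\<close> h count[of w] show "5 \<le> w"
      by (cases "w = 1 \<or> w = 2 \<or> w = 3 \<or> w = 4") auto
  next
    have "weight_count (code G) 5 \<noteq> 0" using count[of 5] h(5) by simp
    then obtain c where "c \<in> code G" "hamming_weight c = 5"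
      unfolding weight_count_def by (metis (mono_tags, lifting) Collect_empty_eq card.empty)
    moreover from this have "c \<noteq> 0" by (auto simp: hamming_weight_def)
    ultimately show "5 \<in> hamming_weight ` (code G - {0})" by force
  qed simp
  moreover have "card (code G) = 2 ^ 11" using card_graph_code[of "adj G"] by simp
  moreover from this have "code G \<noteq> {0}" by auto
  ultimately show "additive_code 11 5 (code G)"
    by (simp add: additive_code_def graph_code_subgroup)
qed

section \<open>The codes\<close>

definition weights_1 :: "nat list" where
  "weights_1 = [1, 0, 0, 0, 0, 55, 242, 275, 495, 605, 286, 89]"

definition weights_2 :: "nat list" where
  "weights_2 = [1, 0, 0, 0, 0, 66, 198, 330, 495, 550, 330, 78]"

definition weights_3 :: "nat list" where
  "weights_3 = [1, 0, 0, 0, 0, 70, 182, 350, 495, 530, 346, 74]"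

definition weights_4 :: "nat list" where
  "weights_4 = [1, 0, 0, 0, 0, 75, 162, 375, 495, 505, 366, 69]"

definition weights_5 :: "nat list" where
  "weights_5 = [1, 0, 0, 0, 0, 77, 154, 385, 495, 495, 374, 67]"

text \<open>The number of rotations times the size of the stabilizer of 0 must equal the last value.
  So in all cases but \<open>certificate_4\<close> only the identity permutation fixes coordinate
  0.\<close>

lemma certificate_1: "certified (circulant [1, 2, 3, 4, 6]) 11 False weights_1 291786 11"
  by code_simp

lemma certificate_2: "certified (circulant [1, 2, 3, 5, 7]) 11 False weights_1 293128 11"
  by code_simp

lemma certificate_3: "certified (circulant [1, 2, 5, 6]) 11 False weights_1 293854 11"
  by code_simp

text \<open>The nonzero squares modulo 11.\<close>

lemma certificate_4: "certified (circulant [1, 3, 4, 5, 9]) 11 True weights_1 284350 110"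
  by code_simp

lemma certificate_5: "certified (bordered [1, 3, 4]) 10 False weights_1 284630 10"
  by code_simp

lemma certificate_6: "certified (circulant [1, 2, 3, 6]) 11 False weights_2 510334 11"
  by code_simp

lemma certificate_7: "certified (circulant [1, 3, 5, 6, 7]) 11 False weights_2 495066 11"
  by code_simp

lemma certificate_8: "certified (circulant [1, 4, 5, 7]) 11 False weights_2 503118 11"
  by code_simp

lemma certificate_9: "certified (circulant [1, 2, 3, 4, 5, 7]) 11 False weights_2 503206 11"
  by code_simp

lemma certificate_10: "certified (bordered [2, 3, 5]) 10 False weights_3 592420 10"
  by code_simp

lemma certificate_11: "certified (bordered [1, 3, 6, 7]) 10 False weights_3 598700 10"
  by code_simp

lemma certificate_12: "certified (bordered [3, 4, 6]) 10 False weights_4 736700 10"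
  by code_simp

lemma certificate_13: "certified (bordered [2, 4, 5]) 10 False weights_4 724440 10"
  by code_simp

lemma certificate_14: "certified (bordered [1, 2, 4]) 10 False weights_4 727900 10"
  by code_simp

lemma certificate_15: "certified (bordered [2, 4, 5, 6]) 10 False weights_4 727580 10"
  by code_simp

lemma certificate_16: "certified (bordered [1, 2, 3, 5]) 10 False weights_4 722780 10"
  by code_simp

lemma certificate_17: "certified (circulant [2, 3, 4, 6]) 11 False weights_5 796642 11"
  by code_simp

lemma certificate_18: "certified (circulant [2, 3, 5, 7, 8]) 11 False weights_5 788634 11"
  by code_simp

lemma certificate_19: "certified (circulant [1, 3, 5, 6]) 11 False weights_5 785334 11"
  by code_simp

lemma certificate_20: "certified (circulant [2, 4, 6, 7]) 11 False weights_5 791142 11"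
  by code_simp

lemma certificate_21: "certified (circulant [1, 3, 4, 5]) 11 False weights_5 789690 11"
  by code_simp

section \<open>The 21 codes, their inequivalence and their counts\<close>

definition family :: "(bool list list \<times> nat list \<times> int \<times> nat) list" where
  "family =
    [(circulant [1, 2, 3, 4, 6], weights_1, 291786, 11),
     (circulant [1, 2, 3, 5, 7], weights_1, 293128, 11),
     (circulant [1, 2, 5, 6], weights_1, 293854, 11),
     (circulant [1, 3, 4, 5, 9], weights_1, 284350, 110),
     (bordered [1, 3, 4], weights_1, 284630, 10),
     (circulant [1, 2, 3, 6], weights_2, 510334, 11),
     (circulant [1, 3, 5, 6, 7], weights_2, 495066, 11),
     (circulant [1, 4, 5, 7], weights_2, 503118, 11),
     (circulant [1, 2, 3, 4, 5, 7], weights_2, 503206, 11),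
     (bordered [2, 3, 5], weights_3, 592420, 10),
     (bordered [1, 3, 6, 7], weights_3, 598700, 10),
     (bordered [3, 4, 6], weights_4, 736700, 10),
     (bordered [2, 4, 5], weights_4, 724440, 10),
     (bordered [1, 2, 4], weights_4, 727900, 10),
     (bordered [2, 4, 5, 6], weights_4, 727580, 10),
     (bordered [1, 2, 3, 5], weights_4, 722780, 10),
     (circulant [2, 3, 4, 6], weights_5, 796642, 11),
     (circulant [2, 3, 5, 7, 8], weights_5, 788634, 11),
     (circulant [1, 3, 5, 6], weights_5, 785334, 11),
     (circulant [2, 4, 6, 7], weights_5, 791142, 11),
     (circulant [1, 3, 4, 5], weights_5, 789690, 11)]"

lemmas certificates =
  certificate_1 certificate_2 certificate_3 certificate_4 certificate_5
  certificate_6 certificate_7 certificate_8 certificate_9 certificate_10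
  certificate_11 certificate_12 certificate_13 certificate_14 certificate_15
  certificate_16 certificate_17 certificate_18 certificate_19 certificate_20
  certificate_21

lemma family_certified: "list_all (\<lambda>(G, h, s, a). \<exists>m b. certified G m b h s a) family"
  unfolding family_def list.pred_inject prod.case
  by (intro conjI exI list.pred_inject(1); rule certificates)

lemma Poly_weights:
  "Poly (map int weights_1) = W_11_1" "Poly (map int weights_2) = W_11_2"
  "Poly (map int weights_3) = W_11_3" "Poly (map int weights_4) = W_11_4"
  "Poly (map int weights_5) = W_11_5"
  by (simp_all add: weights_1_def weights_2_def weights_3_def weights_4_def weights_5_def
      W_11_1_def W_11_2_def W_11_3_def W_11_4_def W_11_5_def)

lemma family_weights:
  "(G, h, s, a) \<in> set family \<Longrightarrow> h ! 1 = 0 \<and> h ! 2 = 0 \<and> h ! 3 = 0 \<and> h ! 4 = 0 \<and> 0 < h ! 5"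
  by (auto simp: family_def weights_1_def weights_2_def weights_3_def weights_4_def weights_5_def)

lemma distinct_signatures: "distinct (map (\<lambda>(G, h, s, a). s) family)"
  by (simp add: family_def)

lemma family_codes:
  assumes "(G, h, s, a) \<in> set family"
  shows "additive_code 11 5 (code G)" "formally_self_dual (code G)"
    "poly (weight_enumerator (code G)) 1 = Poly (map int h)"
    "signature 5 (code G) = s" "card (automorphism_group (code G)) = a"
proof -
  obtain m b where "certified G m b h s a"
    using family_certified assms by (auto simp: list_all_iff)
  moreover have "h ! 1 = 0" "h ! 2 = 0" "h ! 3 = 0" "h ! 4 = 0" "0 < h ! 5"
    using family_weights[OF assms] by blast+
  ultimately show "additive_code 11 5 (code G)" "formally_self_dual (code G)"
    "poly (weight_enumerator (code G)) 1 = Poly (map int h)"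
    "signature 5 (code G) = s" "card (automorphism_group (code G)) = a"
    by (rule certified_code)+
qed

definition family_code :: "bool list list \<times> nat list \<times> int \<times> nat \<Rightarrow> (gf4 ^ 11) set" where
  "family_code x = code (fst x)"

lemma signature_family_code: "x \<in> set family \<Longrightarrow> signature 5 (family_code x) = fst (snd (snd x))"
  by (cases x) (simp add: family_code_def family_codes)

lemma inj_on_family_signature: "inj_on (\<lambda>x. fst (snd (snd x))) (set family)"
  using distinct_signatures by (simp add: distinct_map case_prod_unfold)

lemma inj_on_family_code: "inj_on family_code (set family)"
proof (rule inj_onI)
  fix x y assume xy: "x \<in> set family" "y \<in> set family" and "family_code x = family_code y"
  then have "fst (snd (snd x)) = fst (snd (snd y))"
    using signature_family_code[OF xy(1)] signature_family_code[OF xy(2)] by simp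
  with xy show "x = y" by (intro inj_onD[OF inj_on_family_signature])
qed

text \<open>Distinct signatures make \<open>family_code\<close> injective, so cardinalities of sets
  of codes become lengths of filtered lists, which can be computed.\<close>

lemma card_family_filter: "card (family_code ` {x \<in> set family. P x}) = length (filter P family)"
proof -
  have "inj_on family_code {x \<in> set family. P x}"
    by (rule inj_on_subset[OF inj_on_family_code]) auto
  moreover have "distinct (filter P family)"
    using distinct_signatures by (simp add: distinct_map)
  ultimately show ?thesis
    using distinct_card[of "filter P family"] by (simp add: card_image)
qed

lemma card_codes_with_family:
  "card (codes_with (family_code ` set family) w) =
    length (filter (\<lambda>(G, h, s, a). Poly (map int h) = w) family)"
proof -
  have "codes_with (family_code ` set family) w =
      family_code ` {x \<in> set family. case x of (G, h, s, a) \<Rightarrow> Poly (map int h) = w}"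
    by (auto simp: codes_with_def family_code_def family_codes)
  then show ?thesis by (simp only: card_family_filter)
qed

lemma card_codes_with_aut_family:
  "card (codes_with_aut (family_code ` set family) w m) =
    length (filter (\<lambda>(G, h, s, a). Poly (map int h) = w \<and> a = m) family)"
proof -
  have "codes_with_aut (family_code ` set family) w m =
      family_code ` {x \<in> set family. case x of (G, h, s, a) \<Rightarrow> Poly (map int h) = w \<and> a = m}"
    by (auto simp: codes_with_aut_def codes_with_def family_code_def family_codes)
  then show ?thesis by (simp only: card_family_filter)
qed

theorem mainTheorem5:
  shows "\<exists>\<S> :: (gf4 ^ 11) set set.
    finite \<S> \<and> card \<S> = 21 \<and>
    (\<forall>C\<in>\<S>. additive_code 11 5 C \<and> formally_self_dual C) \<and>
    pairwise (\<lambda>C D. \<not> equivalent_codes C D) \<S> \<and>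
    card (codes_with \<S> W_11_1) = 5 \<and>
      card (codes_with_aut \<S> W_11_1 11) = 3 \<and>
      card (codes_with_aut \<S> W_11_1 10) = 1 \<and>
      card (codes_with_aut \<S> W_11_1 110) = 1 \<and>
    card (codes_with \<S> W_11_2) = 4 \<and>
      card (codes_with_aut \<S> W_11_2 11) = 4 \<and>
    card (codes_with \<S> W_11_3) = 2 \<and>
      card (codes_with_aut \<S> W_11_3 10) = 2 \<and>
    card (codes_with \<S> W_11_4) = 5 \<and>
      card (codes_with_aut \<S> W_11_4 10) = 5 \<and>
    card (codes_with \<S> W_11_5) = 5 \<and>
      card (codes_with_aut \<S> W_11_5 11) = 5"
  proof (intro exI[of _ "family_code ` set family"] conjI)
  show "finite (family_code ` set family)" by simp
  show "card (family_code ` set family) = 21"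
    using distinct_signatures 
    by (simp add: card_image[OF inj_on_family_code] distinct_map distinct_card)
      (simp add: family_def)
  show "\<forall>C\<in>family_code ` set family. additive_code 11 5 C \<and> formally_self_dual C"
    by (auto simp: family_code_def family_codes)
  show "pairwise (\<lambda>C D. \<not> equivalent_codes C D) (family_code ` set family)"
  proof (rule pairwiseI, clarify)
    fix x y assume xy: "x \<in> set family" "y \<in> set family"
      and "family_code x \<noteq> family_code y" "equivalent_codes (family_code x) (family_code y)"
    then have "signature 5 (family_code x) = signature 5 (family_code y)"
      by (intro equivalent_codes_signature)
    then have "x = y"
      using xy inj_on_family_signature by (simp add: signature_family_code inj_onD)
    with \<open>family_code x \<noteq> family_code y\<close> show False by simp
  qed
\<comment> \<open>The remaining goals count codes by enumerator and group order. They reduce to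
  filtering the 21 entries, where the polynomials are compared by their coefficients.\<close>
qed (unfold card_codes_with_family card_codes_with_aut_family,
    simp_all add: family_def Poly_weights W_11_1_def W_11_2_def W_11_3_def W_11_4_def W_11_5_def)

end
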